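(* Let $A_1,\dots,A_n$ be the vertices of a regular icosahedron ($n=12$) or of a regular dodecahedron ($n=20$) in Euclidean $3$-space with circumradius $R>0$. Let $m\in\{1,2,3,4,5\}$ and let $c$ be a real constant with $c>nR^{2m}$. Then the locus of points $M$ in the space such that $$\sum_{i=1}^n d_i^{2m}=c,\qquad d_i=|MA_i|,$$ is a sphere whose center is the centroid of the icosahedron (respectively, dodecahedron).
   Context: $|MA_i|$ denotes Euclidean distance. A sphere means a sphere of positive radius. *)

theory Defs
  imports "HOL-Analysis.Analysis"
begin

text \<open>
  The solid (two-dimensional) regular p-gon of circumradius r, lying in some plane of the
  ambient Euclidean space: centre a, plane directions spanned by the orthonormal pair u, w.
\<close>

definition regular_polygon :: "nat \<Rightarrow> real \<Rightarrow> 'a::euclidean_space set \<Rightarrow> bool" where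
  "regular_polygon p r F \<longleftrightarrow> 3 \<le> p \<and> 0 < r \<and>
    (\<exists>a u w. norm u = 1 \<and> norm w = 1 \<and> u \<bullet> w = 0 \<and>
      F = convex hull
        ((\<lambda>k. a + (r * cos (2 * pi * real k / real p)) *\<^sub>R u
                + (r * sin (2 * pi * real k / real p)) *\<^sub>R w) ` {..<p}))"

definition vertices :: "'a::euclidean_space set \<Rightarrow> 'a set" where
  "vertices P = {v. v extreme_point_of P}"

text \<open>
  Platonic solid with Schlaefli symbol (p, q): a nondegenerate convex polyhedron whose faces
  are congruent regular p-gons, q of them meeting at every vertex.  Congruence of the faces
  is expressed by the common circumradius r.
\<close>

definition platonic_solid :: "nat \<Rightarrow> nat \<Rightarrow> (real^3) set \<Rightarrow> bool" where
  "platonic_solid p q P \<longleftrightarrow> polytope P \<and> aff_dim P = 3 \<and>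
    (\<exists>r. \<forall>F. F facet_of P \<longrightarrow> regular_polygon p r F) \<and>
    (\<forall>v\<in>vertices P. card {F. F facet_of P \<and> v \<in> F} = q)"

definition regular_icosahedron :: "(real^3) set \<Rightarrow> bool" where
  "regular_icosahedron P \<longleftrightarrow> platonic_solid 3 5 P"

definition regular_dodecahedron :: "(real^3) set \<Rightarrow> bool" where
  "regular_dodecahedron P \<longleftrightarrow> platonic_solid 5 3 P"

definition has_circumradius :: "(real^3) set \<Rightarrow> real \<Rightarrow> bool" where
  "has_circumradius P R \<longleftrightarrow> (\<exists>z. vertices P \<subseteq> sphere z R)"

text \<open>The centroid of a solid body: its centre of mass for uniform density.\<close>

definition centroid :: "'a::euclidean_space set \<Rightarrow> 'a" where
  "centroid P = (1 / measure lebesgue P) *\<^sub>R integral P (\<lambda>x. x)"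

end

theory Submission
  imports Defs
begin

text \<open>
  Normalise so that the vertices are unit vectors, the circumcentre being the origin. Facets are
  regular polygons, and every side of a facet lies in a second facet because a proper face of a
  polytope is the intersection of the facets containing it. At each vertex this forces a closed
  cycle of neighbours: five for the icosahedron (three for the dodecahedron), lying at a common
  angle from the vertex, with consecutive ones at a common angle from each other. This fixes the
  angles (up to a conjugation that leaves the set of vertices unchanged), and each facet determines
  its neighbours by an explicit linear rule. Iterating the rule
  from one corner yields 12 (respectively 20) vectors, expressed in the basis given by the corner
  with coefficients in \<open>\<int>[(1 + sqrt 5) / 2]\<close>; by the cardinality assumption these are all vertices.

  The resulting set \<open>V\<close> is centrally symmetric, which identifies the centroid with the circumcentre,
  and its second and fourth moments are isotropic, i.e. \<open>V\<close> is a spherical 5-design. Expanding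
  \<open>|x - p|\<^sup>2 = |x|\<^sup>2 + 1 - 2 (x \<bullet> p)\<close> to the power \<open>m \<le> 5\<close> and summing over \<open>p\<close> therefore gives a
  function of \<open>|x|\<^sup>2\<close> alone, which is strictly increasing and equals \<open>card V\<close> at \<open>x = 0\<close>.
\<close>

subsection \<open>Vectors in three-space\<close>

text \<open>In three dimensions the vectors perpendicular to two independent ones form a line, and
  two orthogonal vectors on a line cannot both be nonzero. The last assumption is independence in
  Cauchy-Schwarz form. This turns equations between inner products into an equation between
  vectors.\<close>

lemma perpendicular_to_pair:
  fixes a b x y :: "real^3"
  assumes "x \<bullet> a = 0" "x \<bullet> b = 0" "y \<bullet> a = 0" "y \<bullet> b = 0" "x \<bullet> y = 0"
    and "(a \<bullet> a) * (b \<bullet> b) \<noteq> (a \<bullet> b)\<^sup>2"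
  shows "x = 0 \<or> y = 0"
proof -
  define n where "n = cross3 a b"
  have n: "n \<bullet> n \<noteq> 0"
    using norm_cross_dot[of a b] assms(6)
    by (auto simp: n_def power2_norm_eq_inner power_mult_distrib)
  \<comment> \<open>The triple product \<open>cross3 u (cross3 a b)\<close> vanishes, so
    \<open>u\<close> is a multiple of \<open>n\<close>; expanding
    \<open>cross3 n (cross3 u n)\<close> gives the factor.\<close>
  have par: "(n \<bullet> n) *\<^sub>R u = (u \<bullet> n) *\<^sub>R n" if "u \<bullet> a = 0" "u \<bullet> b = 0" for u
  proof -
    have "cross3 n (cross3 u n) = 0"
      using that Lagrange[of u a b] by (simp add: n_def)
    then show ?thesis
      using Lagrange[of n u n] by (simp add: inner_commute)
  qed
  have "(n \<bullet> n) *\<^sub>R x \<bullet> (n \<bullet> n) *\<^sub>R y = 0"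
    using assms(5) by simp
  then have "(x \<bullet> n) * ((y \<bullet> n) * (n \<bullet> n)) = 0"
    unfolding par[OF assms(1,2)] par[OF assms(3,4)] by auto
  then have "x \<bullet> n = 0 \<or> y \<bullet> n = 0"
    using n by (metis mult_eq_0_iff)
  then show ?thesis
    using par[OF assms(1,2)] par[OF assms(3,4)] n by auto
qed

text \<open>The determinant of the Gram matrix, expanded so that it can be evaluated from the six
  inner products; it is nonzero exactly when the vectors are independent.\<close>

definition gram3 :: "'a::real_inner \<Rightarrow> 'a \<Rightarrow> 'a \<Rightarrow> real" where
  "gram3 a b c = (a \<bullet> a) * (b \<bullet> b) * (c \<bullet> c) + 2 * (a \<bullet> b) * (b \<bullet> c) * (a \<bullet> c)
     - (a \<bullet> a) * (b \<bullet> c)\<^sup>2 - (b \<bullet> b) * (a \<bullet> c)\<^sup>2 - (c \<bullet> c) * (a \<bullet> b)\<^sup>2"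

lemma gram3_triple_product:
  fixes a b c :: "real^3"
  shows "gram3 a b c = (a \<bullet> cross3 b c)\<^sup>2"
  by (simp add: gram3_def cross3_simps power2_eq_square)

text \<open>The cross products are, up to the factor \<open>D\<close>, the dual basis. The vector
  found serves as a linear functional that tells combinations of \<open>a\<close>, \<open>b\<close>,
  \<open>c\<close> apart.\<close>

lemma dual_vector:
  fixes a b c :: "real^3"
  assumes "gram3 a b c \<noteq> 0"
  obtains x where "x \<bullet> a = s" "x \<bullet> b = t" "x \<bullet> c = u"
proof
  define D where "D = a \<bullet> cross3 b c"
  have D: "D \<noteq> 0" using assms by (auto simp: gram3_triple_product D_def)
  have e: "D = b \<bullet> cross3 c a" "D = c \<bullet> cross3 a b"
    by (auto simp: D_def cross3_simps)
  let ?x = "(1 / D) *\<^sub>R (s *\<^sub>R cross3 b c + t *\<^sub>R cross3 c a + u *\<^sub>R cross3 a b)"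
  show "?x \<bullet> a = s" "?x \<bullet> b = t" "?x \<bullet> c = u"
    using D by (simp_all add: inner_add_left dot_cross_self,
        simp_all add: inner_commute D_def[symmetric] e[symmetric])
qed

lemma eq_0_if_perpendicular_basis:
  fixes a b c :: "real^3"
  assumes "gram3 a b c \<noteq> 0" "x \<bullet> a = 0" "x \<bullet> b = 0" "x \<bullet> c = 0"
  shows "x = 0"
proof -
  have "(a \<bullet> cross3 b c) *\<^sub>R x = (x \<bullet> a) *\<^sub>R cross3 b c + (x \<bullet> b) *\<^sub>R cross3 c a + (x \<bullet> c) *\<^sub>R cross3 a b"
    by (simp add: cross3_simps forall_3)
  then show ?thesis
    using assms by (auto simp: gram3_triple_product)
qed

text \<open>That the moment operator is a multiple of the identity need only be checked on a basis.
  Being self-adjoint, it can be moved onto the basis vectors, so \<open>x\<close> is never expanded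
  in them.\<close>

lemma second_moment_of_frame:
  fixes a b c x :: "real^3"
  assumes "finite V" "gram3 a b c \<noteq> 0"
    and "(\<Sum>p\<in>V. (a \<bullet> p) *\<^sub>R p) = \<mu> *\<^sub>R a" "(\<Sum>p\<in>V. (b \<bullet> p) *\<^sub>R p) = \<mu> *\<^sub>R b"
      "(\<Sum>p\<in>V. (c \<bullet> p) *\<^sub>R p) = \<mu> *\<^sub>R c"
  shows "(\<Sum>p\<in>V. (x \<bullet> p)\<^sup>2) = \<mu> * (x \<bullet> x)"
proof -
  let ?T = "\<lambda>x. \<Sum>p\<in>V. (x \<bullet> p) *\<^sub>R p"
  have sym: "?T x \<bullet> y = ?T y \<bullet> x" for x y
    by (simp add: inner_sum_left inner_sum_right inner_commute mult.commute)
  have "?T x - \<mu> *\<^sub>R x = 0"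
    by (rule eq_0_if_perpendicular_basis[OF assms(2)])
      (simp_all only: inner_diff_left sym[of x] assms(3-5), simp_all add: inner_commute)
  then have "?T x \<bullet> x = \<mu> * (x \<bullet> x)" by simp
  then show ?thesis
    by (simp add: inner_sum_left inner_sum_right power2_eq_square inner_commute)
qed

text \<open>The coordinates are separate arguments, so that passing from one corner to the next is
  arithmetic on three coefficients.\<close>

definition lin_comb :: "'a::real_vector \<Rightarrow> 'a \<Rightarrow> 'a \<Rightarrow> real \<Rightarrow> real \<Rightarrow> real \<Rightarrow> 'a" where
  "lin_comb a b c i j l = i *\<^sub>R a + j *\<^sub>R b + l *\<^sub>R c"

lemma lin_comb_arith:
  "lin_comb a b c i j l + lin_comb a b c i' j' l' = lin_comb a b c (i + i') (j + j') (l + l')"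
  "lin_comb a b c i j l - lin_comb a b c i' j' l' = lin_comb a b c (i - i') (j - j') (l - l')"
  "- lin_comb a b c i j l = lin_comb a b c (- i) (- j) (- l)"
  "r *\<^sub>R lin_comb a b c i j l = lin_comb a b c (r * i) (r * j) (r * l)"
  by (simp_all add: lin_comb_def algebra_simps)

lemma inner_lin_comb: "x \<bullet> lin_comb a b c i j l = i * (x \<bullet> a) + j * (x \<bullet> b) + l * (x \<bullet> c)"
  by (simp add: lin_comb_def inner_add_right)

subsection \<open>Corners of facets\<close>

text \<open>
  Facets are represented by their vertex sets. The cosines \<open>\<alpha>\<close> and \<open>\<beta>\<close> are those between
  a vertex and a neighbour along a side, and between the two neighbours in a common facet.
\<close>

locale vertex_figures =
  fixes V :: "(real^3) set" and Fs :: "(real^3) set set" and \<alpha> \<beta> :: real and q :: nat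
  assumes facet_subset: "f \<in> Fs \<Longrightarrow> f \<subseteq> V"
    and unit: "v \<in> V \<Longrightarrow> v \<bullet> v = 1"
    and neighbours: "f \<in> Fs \<Longrightarrow> v \<in> f \<Longrightarrow>
      \<exists>w w'. w \<noteq> w' \<and> {x \<in> f. x \<bullet> v = \<alpha>} = {w, w'} \<and> w \<bullet> w' = \<beta>"
    and side: "f \<in> Fs \<Longrightarrow> v \<in> f \<Longrightarrow> w \<in> f \<Longrightarrow> w \<bullet> v = \<alpha> \<Longrightarrow>
      \<exists>g\<in>Fs. g \<noteq> f \<and> v \<in> g \<and> w \<in> g"
    and shared: "f \<in> Fs \<Longrightarrow> g \<in> Fs \<Longrightarrow> {v, w, w'} \<subseteq> f \<inter> g \<Longrightarrow> w \<noteq> w' \<Longrightarrow>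
      w \<bullet> v = \<alpha> \<Longrightarrow> w' \<bullet> v = \<alpha> \<Longrightarrow> f = g"
    and degree: "v \<in> V \<Longrightarrow> card {f \<in> Fs. v \<in> f} = q"
    and alpha_less: "\<alpha> < 1"
begin

text \<open>The order of \<open>w\<close> and \<open>w'\<close> gives a direction of travel round
  \<open>v\<close>: a walk enters the facet through the side \<open>v w\<close> and leaves it
  through \<open>v w'\<close>.\<close>

definition corner :: "(real^3) set \<Rightarrow> real^3 \<Rightarrow> real^3 \<Rightarrow> real^3 \<Rightarrow> bool" where
  "corner f v w w' \<longleftrightarrow> f \<in> Fs \<and> v \<in> f \<and> w \<in> f \<and> w' \<in> f \<and> w \<noteq> w' \<and> w \<bullet> v = \<alpha> \<and> w' \<bullet> v = \<alpha>"

lemma corner_facet: "corner f v w w' \<Longrightarrow> f \<in> Fs \<and> v \<in> f"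
  by (simp add: corner_def)

lemma corner_sym: "corner f v w w' \<Longrightarrow> corner f v w' w"
  by (auto simp: corner_def)

lemma corner_uniq:
  assumes "corner f v w w'" "x \<in> f" "x \<bullet> v = \<alpha>"
  shows "x = w \<or> x = w'"
proof -
  obtain a b where "{x \<in> f. x \<bullet> v = \<alpha>} = {a, b}"
    using neighbours[of f v] assms by (auto simp: corner_def)
  moreover have "{w, w', x} \<subseteq> {x \<in> f. x \<bullet> v = \<alpha>}" "w \<noteq> w'"
    using assms by (auto simp: corner_def)
  ultimately show ?thesis by auto
qed

lemma corner_inner:
  assumes "corner f v w w'" shows "w \<bullet> w' = \<beta>"
proof -
  obtain a b where "{x \<in> f. x \<bullet> v = \<alpha>} = {a, b}" "a \<bullet> b = \<beta>"
    using neighbours[of f v] assms by (auto simp: corner_def)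
  moreover have "{w, w'} \<subseteq> {x \<in> f. x \<bullet> v = \<alpha>}" "w \<noteq> w'"
    using assms by (auto simp: corner_def)
  ultimately show ?thesis by (auto simp: inner_commute)
qed

lemma corner_exists: "f \<in> Fs \<Longrightarrow> v \<in> f \<Longrightarrow> \<exists>w w'. corner f v w w'"
  using neighbours[of f v] unfolding corner_def by blast

lemma corner_in_facet:
  assumes "f \<in> Fs" "v \<in> f" "w \<in> f" "w \<bullet> v = \<alpha>"
  shows "\<exists>x. corner f v w x"
  using corner_exists[OF assms(1,2)] corner_uniq[OF _ assms(3,4)] corner_sym by blast

text \<open>One step of the walk round \<open>v\<close>, across the side \<open>v w'\<close>. It
  cannot lead back to \<open>w\<close>, as two facets sharing \<open>v\<close>, \<open>w\<close> and
  \<open>w'\<close> coincide.\<close>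

lemma corner_next:
  assumes "corner f v w w'"
  shows "\<exists>g x. corner g v w' x \<and> g \<noteq> f \<and> x \<noteq> w"
proof -
  obtain g where g: "g \<in> Fs" "g \<noteq> f" "v \<in> g" "w' \<in> g"
    using side[of f v w'] assms by (auto simp: corner_def)
  obtain x where x: "corner g v w' x"
    using corner_in_facet g assms by (meson corner_def)
  then have "x \<noteq> w"
    using shared[of f g v w w'] assms g by (auto simp: corner_def)
  then show ?thesis using x g by blast
qed

lemma corner_shared: "corner f v w w' \<Longrightarrow> corner g v w w' \<Longrightarrow> f = g"
  using shared[of f g v w w'] by (auto simp: corner_def)

lemma corner_mem: "corner f v w w' \<Longrightarrow> v \<in> V \<and> w \<in> V \<and> w' \<in> V"
  using facet_subset by (auto simp: corner_def)

lemma corner_unit: "corner f v w w' \<Longrightarrow> v \<bullet> v = 1 \<and> w \<bullet> w = 1 \<and> w' \<bullet> w' = 1"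
  using corner_mem unit by blast

text \<open>Once \<open>q\<close> facets through \<open>v\<close> have been found there is no other;
  this is what forces a walk round \<open>v\<close> to close.\<close>

lemma facets_at_vertex:
  assumes "v \<in> V" "T \<subseteq> {f \<in> Fs. v \<in> f}" "card T = q" "q > 0" "f \<in> Fs" "v \<in> f"
  shows "f \<in> T"
  using card_subset_eq[of "{f \<in> Fs. v \<in> f}" T] degree[OF assms(1)] assms
  by (metis (no_types, lifting) card.infinite mem_Collect_eq not_gr0)

text \<open>Since \<open>|v + x|^2 = 2 + 2 * \<alpha>\<close> for a neighbour \<open>x\<close>, a
  cosine of -1 or less would make both neighbours equal to \<open>- v\<close>.\<close>

lemma alpha_greater:
  assumes "corner f v w w'" shows "-1 < \<alpha>"
proof (rule ccontr)
  assume *: "\<not> -1 < \<alpha>"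
  have "(v + x) \<bullet> (v + x) = 2 + 2 * \<alpha>" if "x \<bullet> x = 1" "x \<bullet> v = \<alpha>" for x
    using that corner_unit[OF assms] by (simp add: inner_add inner_commute)
  then have "v + x = 0" if "x \<bullet> x = 1" "x \<bullet> v = \<alpha>" for x
    using that * inner_ge_zero[of "v + x"] inner_eq_zero_iff[of "v + x"] by fastforce
  then have "v + w = v + w'"
    using assms corner_unit[OF assms] by (simp add: corner_def)
  then show False using assms by (simp add: corner_def)
qed

text \<open>
  Both \<open>x\<close> and \<open>y\<close> lie on the line \<open>{u. u \<bullet> v = u \<bullet> w = \<alpha>}\<close> and on the unit sphere,
  hence they are mirror images in the plane spanned by \<open>v\<close> and \<open>w\<close>.
\<close>

lemma corner_flip:
  assumes c: "corner f v w x" "corner g v w y" "x \<noteq> y" and "\<alpha> = \<beta>"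
  shows "y = (2 * \<alpha> / (1 + \<alpha>)) *\<^sub>R (v + w) - x"
proof -
  \<comment> \<open>With this factor \<open>k *\<^sub>R (v + w)\<close> has inner product
    \<open>2 * \<alpha>\<close> with \<open>v\<close> and with \<open>w\<close>, just as
    \<open>x + y\<close> has.\<close>
  define k where "k = 2 * \<alpha> / (1 + \<alpha>)"
  have k: "k * (1 + \<alpha>) = 2 * \<alpha>"
    using alpha_greater[OF c(1)] by (simp add: k_def)
  have i: "v \<bullet> v = 1" "w \<bullet> w = 1" "x \<bullet> x = 1" "y \<bullet> y = 1" "w \<bullet> v = \<alpha>" "x \<bullet> v = \<alpha>" "y \<bullet> v = \<alpha>"
    "x \<bullet> w = \<alpha>" "y \<bullet> w = \<alpha>"
    using corner_unit[OF c(1)] corner_unit[OF c(2)] corner_inner[OF corner_sym[OF c(1)]]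
      corner_inner[OF corner_sym[OF c(2)]] c assms(4) unfolding corner_def by metis+
  have i': "v \<bullet> w = \<alpha>" "v \<bullet> x = \<alpha>" "v \<bullet> y = \<alpha>" "w \<bullet> x = \<alpha>" "w \<bullet> y = \<alpha>"
    using i by (simp_all only: inner_commute)
  note ii = i i'
  have "x - y = 0 \<or> x + y - k *\<^sub>R (v + w) = 0"
  proof (rule perpendicular_to_pair[of _ v w])
    have "\<alpha>\<^sup>2 < 1"
      using alpha_greater[OF c(1)] alpha_less by (simp add: abs_square_less_1)
    then show "(v \<bullet> v) * (w \<bullet> w) \<noteq> (v \<bullet> w)\<^sup>2"
      by (simp add: ii)
    show "(x + y - k *\<^sub>R (v + w)) \<bullet> v = 0" "(x + y - k *\<^sub>R (v + w)) \<bullet> w = 0"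
      using k by (simp_all add: inner_add_left inner_diff_left ii algebra_simps)
    show "(x - y) \<bullet> v = 0" "(x - y) \<bullet> w = 0"
      by (simp_all add: inner_diff_left ii)
    show "(x - y) \<bullet> (x + y - k *\<^sub>R (v + w)) = 0"
      by (simp add: inner_diff_left inner_diff_right inner_add_right ii inner_commute[of y x]
          i(6,7,8,9))
  qed
  then show ?thesis using c(3) by (simp add: k_def algebra_simps)
qed

end

text \<open>
  Here \<open>g2\<close> and \<open>g3\<close> stand for \<open>w0 \<bullet> w2\<close> and \<open>w0 \<bullet> w3\<close>. The negative root of
  \<open>k\<^sup>2 + k = 1\<close> belongs to the great icosahedron; it need not be excluded, because its vertices
  are those of an ordinary icosahedron.
\<close>

lemma recurrence_five_cycle:
  fixes k a g2 g3 g4 :: real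
  assumes k: "k * (1 + a) = 2 * a" and a: "a < 1"
    and g: "g2 = k * (a + a) - 1" "g3 = k * (a + g2) - a" "k * (a + a) - g3 = 1"
  shows "k\<^sup>2 + k = 1"
proof -
  have "g3 = g2" using g by simp
  \<comment> \<open>The assumption on \<open>k\<close> gives \<open>(2 - k) * a = k\<close>, so the
    factor \<open>2 - k\<close> removes \<open>a\<close>.\<close>
  moreover have "(2 - k) * (g3 - g2) = 2 * (k - 1) * (k\<^sup>2 + k - 1)"
    using k g(1,2) by algebra
  ultimately have "(k - 1) * (k\<^sup>2 + k - 1) = 0" by simp
  moreover have "k \<noteq> 1" using k a by auto
  ultimately show ?thesis by simp
qed

section \<open>The cycle of five triangles round a vertex\<close>

locale icosahedral_figures = vertex_figures V Fs \<alpha> \<alpha> 5 for V Fs \<alpha>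
begin

text \<open>Any vertex other than \<open>x\<close> forming a corner with \<open>v\<close> and
  \<open>w\<close> is the mirror image of \<open>x\<close>, so at most two vertices do so.\<close>

lemma three_corners:
  assumes "corner f v w x" "corner g v w y" "corner h v w t"
  shows "x = y \<or> x = t \<or> y = t"
  using corner_flip[OF assms(1,2)] corner_flip[OF assms(1,3)] by auto

lemma two_corners:
  assumes "corner f v w x" "corner g v w y" "x \<noteq> y" "corner h v w t"
  shows "t = x \<and> h = f \<or> t = y \<and> h = g"
  using three_corners[OF assms(1,2,4)] assms corner_shared by blast

lemma five_facets:
  assumes "v \<in> V" "f0 \<in> Fs" "f1 \<in> Fs" "f2 \<in> Fs" "f3 \<in> Fs" "f4 \<in> Fs"
    "v \<in> f0" "v \<in> f1" "v \<in> f2" "v \<in> f3" "v \<in> f4" "distinct [f0, f1, f2, f3, f4]"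
    "f \<in> Fs" "v \<in> f"
  shows "f \<in> {f0, f1, f2, f3, f4}"
  by (rule facets_at_vertex[OF assms(1)]) (use assms in auto)

text \<open>If three facets closed up round \<open>v\<close>, the sides \<open>v w0\<close>,
  \<open>v w1\<close>, \<open>v w2\<close> would be saturated, having two corners each. A further
  facet \<open>f\<close> at \<open>v\<close> would need partners across both of its sides there,
  outside the cycle. Only one facet is left for this, so it would share a whole corner with
  \<open>f\<close>.\<close>

lemma not_three_cycle:
  assumes c: "corner f0 v w0 w1" "corner f1 v w1 w2" "corner f2 v w2 w0"
  shows False
proof -
  note cd = corner_def
  have dist: "f0 \<noteq> f1" "f0 \<noteq> f2" "f1 \<noteq> f2"
    using corner_uniq[OF c(1), of w2] corner_uniq[OF c(2), of w0] c by (auto simp: cd)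
  have v: "v \<in> V" using corner_mem c by blast
  have nz: "w1 \<noteq> w2" "w0 \<noteq> w2" "w1 \<noteq> w0" using c by (auto simp: cd)
  have closed: "f \<in> {f0, f1, f2}" if "corner f v a b" "a \<in> {w0, w1, w2}" for f a b
    using that two_corners[OF c(1) corner_sym[OF c(3)] nz(1), of f b]
      two_corners[OF corner_sym[OF c(1)] c(2) nz(2), of f b]
      two_corners[OF corner_sym[OF c(2)] c(3) nz(3), of f b] by auto
  have "\<not> {f \<in> Fs. v \<in> f} \<subseteq> {f0, f1, f2}"
  proof
    assume "{f \<in> Fs. v \<in> f} \<subseteq> {f0, f1, f2}"
    then have "card {f \<in> Fs. v \<in> f} \<le> card {f0, f1, f2}"
      by (intro card_mono) auto
    then show False using degree[OF v] dist by simp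
  qed
  then obtain f where f: "f \<in> Fs" "v \<in> f" "f \<notin> {f0, f1, f2}" by auto
  obtain a b where ab: "corner f v a b" using corner_exists f by blast
  obtain g b' where g: "corner g v a b'" "g \<noteq> f" "b' \<noteq> b"
    using corner_next[OF corner_sym[OF ab]] by blast
  obtain h a' where h: "corner h v b a'" "h \<noteq> f" "a' \<noteq> a"
    using corner_next[OF ab] by blast
  have "a \<notin> {w0, w1, w2}" "b \<notin> {w0, w1, w2}"
    using closed[OF ab] closed[OF corner_sym[OF ab]] f by auto
  then have gn: "g \<notin> {f0, f1, f2}" "h \<notin> {f0, f1, f2}"
    using corner_uniq[OF c(1), of a] corner_uniq[OF c(2), of a] corner_uniq[OF c(3), of a]
      corner_uniq[OF c(1), of b] corner_uniq[OF c(2), of b] corner_uniq[OF c(3), of b] g(1) h(1)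
    by (auto simp: cd)
  have "h \<in> {f0, f1, f2, f, g}"
    by (rule five_facets[OF v]) (use c[THEN corner_facet] f(1,2) g(1)[THEN corner_facet]
        h(1)[THEN corner_facet] dist f(3) g(2) gn in \<open>simp_all, metis\<close>)
  then have "h = g" using gn h by auto
  then have "b \<in> {a, b'}" using corner_uniq[OF g(1), of b] h by (auto simp: cd)
  then show False using ab g by (auto simp: cd)
qed

text \<open>The walk starting in \<open>f0\<close> cannot close after three or four facets, because
  a leftover facet would lack partners; after five facets no new one is available, so it has to
  close there.\<close>

lemma five_cycle:
  assumes c0: "corner f0 v w0 w1"
  obtains f1 f2 f3 f4 w2 w3 w4 where "corner f1 v w1 w2" "corner f2 v w2 w3"
    "corner f3 v w3 w4" "corner f4 v w4 w0" "w2 \<noteq> w0" "w3 \<noteq> w1" "w4 \<noteq> w2" "w0 \<noteq> w3" "w1 \<noteq> w4"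
proof -
  note cd = corner_def
  have v: "v \<in> V" using corner_mem c0 by blast
  obtain f1 w2 where c1: "corner f1 v w1 w2" "f1 \<noteq> f0" "w2 \<noteq> w0" using corner_next[OF c0] by blast
  obtain f2 w3 where c2: "corner f2 v w2 w3" "f2 \<noteq> f1" "w3 \<noteq> w1" using corner_next[OF c1(1)] by blast
  have w30: "w3 \<noteq> w0" using not_three_cycle c0 c1 c2 by blast
  have f20: "f2 \<noteq> f0" using corner_uniq[OF c0, of w2] c1 c2 by (auto simp: cd)
  obtain f3 w4 where c3: "corner f3 v w3 w4" "f3 \<noteq> f2" "w4 \<noteq> w2" using corner_next[OF c2(1)] by blast
  have w3f: "w3 \<notin> f0" "w3 \<notin> f1"
    using corner_uniq[OF c0] corner_uniq[OF c1(1)] w30 c2 by (auto simp: cd)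
  then have f30: "f3 \<noteq> f0" "f3 \<noteq> f1" using c3 by (auto simp: cd)
  have w41: "w4 \<noteq> w1"
  proof
    assume "w4 = w1"
    then show False
      using two_corners[OF corner_sym[OF c0] c1(1) c1(3)[symmetric], of f3 w3] corner_sym[OF c3(1)]
        f30 by auto
  qed
  have w40: "w4 \<noteq> w0"
  proof
    assume w4: "w4 = w0"
    \<comment> \<open>In a four-cycle a fifth facet \<open>f\<close> would remain. Its partner
      across a side at \<open>v\<close> is one of the four, so that side is already saturated and
      \<open>f\<close> would belong to the cycle.\<close>
    have "\<not> {f \<in> Fs. v \<in> f} \<subseteq> {f0, f1, f2, f3}"
    proof
      assume "{f \<in> Fs. v \<in> f} \<subseteq> {f0, f1, f2, f3}"
      then have "card {f \<in> Fs. v \<in> f} \<le> card {f0, f1, f2, f3}"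
        by (intro card_mono) auto
      also have "\<dots> \<le> 4" by (simp add: card_insert_if)
      finally show False using degree[OF v] by simp
    qed
    then obtain f where f: "f \<in> Fs" "v \<in> f" "f \<notin> {f0, f1, f2, f3}" by auto
    obtain a b where ab: "corner f v a b" using corner_exists f by blast
    obtain g b' where g: "corner g v a b'" "g \<noteq> f"
      using corner_next[OF corner_sym[OF ab]] by blast
    have "g \<in> {f0, f1, f2, f3, f}"
      by (rule five_facets[OF v]) (use c0 c1 c2 c3 f g f20 f30 in \<open>auto simp: cd\<close>)
    then have "g \<in> {f0, f1, f2, f3}" using g by auto
    then have "a \<in> {w0, w1, w2, w3}"
      using corner_uniq[OF c0, of a] corner_uniq[OF c1(1), of a] corner_uniq[OF c2(1), of a]
        corner_uniq[OF c3(1), of a] g(1) w4 by (auto simp: cd)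
    moreover have "corner f3 v w0 w3" using corner_sym[OF c3(1)] w4 by simp
    ultimately have "f \<in> {f0, f1, f2, f3}"
      using two_corners[OF c0 _ c2(3)[symmetric], of f3 f b]
        two_corners[OF corner_sym[OF c0] c1(1) c1(3)[symmetric], of f b]
        two_corners[OF corner_sym[OF c1(1)] c2(1) c2(3)[symmetric], of f b]
        two_corners[OF corner_sym[OF c2(1)] c3(1) c3(3)[symmetric], of f b] ab by auto
    then show False using f by blast
  qed
  obtain f4 w5 where c4: "corner f4 v w4 w5" "f4 \<noteq> f3" "w5 \<noteq> w3" using corner_next[OF c3(1)] by blast
  have "w4 \<notin> f0" "w4 \<notin> f1" "w4 \<notin> f2"
    using corner_uniq[OF c0] corner_uniq[OF c1(1)] corner_uniq[OF c2(1)] w40 w41 c3 by (auto simp: cd)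
  then have f40: "f4 \<noteq> f0" "f4 \<noteq> f1" "f4 \<noteq> f2" using c4 by (auto simp: cd)
  obtain g w6 where g: "corner g v w5 w6" "g \<noteq> f4" using corner_next[OF c4(1)] by blast
  \<comment> \<open>All five facets at \<open>v\<close> are known, so the one across the side
    \<open>v w5\<close> is among them and \<open>w5\<close> is a neighbour met before; every choice
    but \<open>w0\<close> is excluded.\<close>
  have "g \<in> {f0, f1, f2, f3, f4}"
    by (rule five_facets[OF v]) (use c0 c1 c2 c3 c4 g f20 f30 f40 in \<open>auto simp: cd\<close>)
  then have "g \<in> {f0, f1, f2, f3}" using g by auto
  then have "w5 \<in> {w0, w1, w2, w3, w4}"
    using corner_uniq[OF c0, of w5] corner_uniq[OF c1(1), of w5] corner_uniq[OF c2(1), of w5]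
      corner_uniq[OF c3(1), of w5] g(1) by (auto simp: cd)
  moreover have "w5 \<noteq> w4" using c4 by (auto simp: cd)
  moreover have "w5 \<noteq> w1"
    using two_corners[OF corner_sym[OF c0] c1(1) c1(3)[symmetric], of f4 w4] corner_sym[OF c4(1)]
      w40 c3(3) by auto
  moreover have "w5 \<noteq> w2"
    using two_corners[OF corner_sym[OF c1(1)] c2(1) c2(3)[symmetric], of f4 w4] corner_sym[OF c4(1)]
      w41 f40 by auto
  ultimately have "w5 = w0" using c4 by auto
  then show ?thesis using that c1 c2 c3 c4 w30 w41 by blast
qed

end

subsection \<open>The icosahedron\<close>

text \<open>Rational enclosures of both roots, narrow enough to show that the expressions in
  \<open>k\<close> compared below are different.\<close>

lemma golden_bounds:
  fixes k :: real
  assumes "k\<^sup>2 + k = 1"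
  shows "0.618 < k \<and> k < 0.6181 \<or> -1.6181 < k \<and> k < -1.618"
proof -
  have "(k - 0.618) * (k + 1.618) > 0" "(k - 0.6181) * (k + 1.6181) < 0"
    using assms by (simp_all add: algebra_simps power2_eq_square)
  then show ?thesis
    by (auto simp: zero_less_mult_iff mult_less_0_iff)
qed

text \<open>One vertex from each antipodal pair: the triangle \<open>a\<close>, \<open>b\<close>,
  \<open>c\<close> and the images of its vertices under the flips over the opposite sides.\<close>

definition half_icosahedron :: "real \<Rightarrow> 'a::real_vector \<Rightarrow> 'a \<Rightarrow> 'a \<Rightarrow> 'a list" where
  "half_icosahedron k a b c = [lin_comb a b c 1 0 0, lin_comb a b c 0 1 0, lin_comb a b c 0 0 1,
    lin_comb a b c (-1) k k, lin_comb a b c k (-1) k, lin_comb a b c k k (-1)]"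

lemma half_icosahedron_negate:
  "half_icosahedron k (- a) (- b) (- c) = map uminus (half_icosahedron k a b c)"
  by (simp add: half_icosahedron_def lin_comb_def)

lemma half_icosahedron_design:
  fixes a b c x :: "real^3"
  assumes k: "k\<^sup>2 + k = 1" "5 * \<alpha> = 1 + 2 * k"
    and unit: "a \<bullet> a = 1" "b \<bullet> b = 1" "c \<bullet> c = 1"
    and angle: "a \<bullet> b = \<alpha>" "b \<bullet> c = \<alpha>" "a \<bullet> c = \<alpha>"
  defines "L \<equiv> half_icosahedron k a b c @ map uminus (half_icosahedron k a b c)"
  shows "distinct L"
    and "(\<Sum>p\<in>set L. (x \<bullet> p) ^ 2) = 12 / 3 * (x \<bullet> x)"
    and "(\<Sum>p\<in>set L. (x \<bullet> p) ^ 4) = 12 / 5 * (x \<bullet> x)\<^sup>2"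
proof -
  have kk: "k * k = 1 - k" "k * (k * r) = r - k * r" for r
    using k by (simp_all add: power2_eq_square, algebra+)
  have al: "\<alpha> = (1 + 2 * k) / 5" using k by simp
  have i: "a \<bullet> a = 1" "b \<bullet> b = 1" "c \<bullet> c = 1" "a \<bullet> b = \<alpha>" "b \<bullet> c = \<alpha>" "a \<bullet> c = \<alpha>"
    "b \<bullet> a = \<alpha>" "c \<bullet> b = \<alpha>" "c \<bullet> a = \<alpha>"
    using unit angle by (simp_all only: inner_commute)
  have "125 * gram3 a b c = 125 + 2 * (1 + 2 * k) ^ 3 - 15 * (1 + 2 * k)\<^sup>2"
    unfolding gram3_def i al by (simp add: field_simps power2_eq_square power3_eq_cube)
  also have "\<dots> = 60 + 20 * k"
    using k(1) by algebra
  finally have gram: "gram3 a b c \<noteq> 0" using golden_bounds[OF k(1)] by auto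
  \<comment> \<open>The weights are chosen only to make the 12 inner products with \<open>y\<close> pairwise different.\<close>
  obtain y where "y \<bullet> a = 1" "y \<bullet> b = 10" "y \<bullet> c = 100"
    using dual_vector[OF gram] .
  then have "distinct (map (inner y) L)"
    using golden_bounds[OF k(1)] by (auto simp: L_def half_icosahedron_def inner_lin_comb)
  then show dL: "distinct L" by (simp add: distinct_map)
  have sumL: "(\<Sum>p\<in>set L. f p) = sum_list (map f L)" for f :: "real^3 \<Rightarrow> 'z::comm_monoid_add"
    by (rule sum.distinct_set_conv_list[OF dL])
  have T: "(\<Sum>p\<in>set L. (a \<bullet> p) *\<^sub>R p) = lin_comb a b c 4 0 0" "(\<Sum>p\<in>set L. (b \<bullet> p) *\<^sub>R p) = lin_comb a b c 0 4 0"
    "(\<Sum>p\<in>set L. (c \<bullet> p) *\<^sub>R p) = lin_comb a b c 0 0 4"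
    unfolding sumL by (simp_all add: L_def half_icosahedron_def inner_lin_comb lin_comb_arith i al algebra_simps kk
        add_divide_distrib diff_divide_distrib)
  show *: "(\<Sum>p\<in>set L. (x \<bullet> p) ^ 2) = 12 / 3 * (x \<bullet> x)"
    using second_moment_of_frame[OF _ gram, of "set L" 4] T by (simp add: lin_comb_def)
  \<comment> \<open>The factor is \<open>(12 / 5) / 4^2\<close>. Comparing with the square of the
    second moment keeps both sides polynomial in the inner products of \<open>x\<close> with
    \<open>a\<close>, \<open>b\<close>, \<open>c\<close>, where only \<open>k^2 = 1 - k\<close> is
    needed.\<close>
  have "12 / 5 * (x \<bullet> x)\<^sup>2 = (\<Sum>p\<in>set L. (x \<bullet> p) ^ 2)\<^sup>2 * (3 / 20)"
    unfolding * by (simp add: power2_eq_square)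
  also have "\<dots> = (\<Sum>p\<in>set L. (x \<bullet> p) ^ 4)"
    unfolding sumL
    by (simp add: L_def half_icosahedron_def inner_lin_comb power2_eq_square power4_eq_xxxx algebra_simps kk)
  finally show "(\<Sum>p\<in>set L. (x \<bullet> p) ^ 4) = 12 / 5 * (x \<bullet> x)\<^sup>2" ..
qed

section \<open>Generating the icosahedron by flips of one triangle\<close>

context icosahedral_figures
begin

definition k where "k = 2 * \<alpha> / (1 + \<alpha>)"

definition tri where "tri v w w' \<longleftrightarrow> (\<exists>f. corner f v w w')"

text \<open>Three flips in the five-cycle at \<open>v\<close>, leading to \<open>w2\<close>, to
  \<open>w3\<close> and back to \<open>w0\<close>, give the hypotheses of
  \<open>recurrence_five_cycle\<close> after taking inner products with \<open>w0\<close>.\<close>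

lemma k_golden:
  assumes "tri v w0 w1"
  shows "k\<^sup>2 + k = 1" "5 * \<alpha> = 1 + 2 * k"
proof -
  obtain f0 where c0: "corner f0 v w0 w1" using assms by (auto simp: tri_def)
  obtain f1 f2 f3 f4 w2 w3 w4 where c: "corner f1 v w1 w2" "corner f2 v w2 w3"
    "corner f3 v w3 w4" "corner f4 v w4 w0" "w2 \<noteq> w0" "w3 \<noteq> w1" "w4 \<noteq> w2" "w0 \<noteq> w3" "w1 \<noteq> w4"
    using five_cycle[OF c0] .
  have w: "w2 = k *\<^sub>R (v + w1) - w0" "w3 = k *\<^sub>R (v + w2) - w1" "w0 = k *\<^sub>R (v + w4) - w3"
    unfolding k_def using corner_flip[OF corner_sym[OF c0] c(1)] corner_flip[OF corner_sym[OF c(1)] c(2)]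
      corner_flip[OF corner_sym[OF c(3)] c(4)] c by auto
  have i: "w0 \<bullet> v = \<alpha>" "w0 \<bullet> w1 = \<alpha>" "w0 \<bullet> w4 = \<alpha>" "w0 \<bullet> w0 = 1"
    using c0 c(4) corner_inner[OF c0] corner_inner[OF corner_sym[OF c(4)]] corner_unit[OF c0]
    unfolding corner_def by auto
  have g: "w0 \<bullet> w2 = k * (\<alpha> + \<alpha>) - 1" "w0 \<bullet> w3 = k * (\<alpha> + w0 \<bullet> w2) - \<alpha>" "w0 \<bullet> w0 = k * (\<alpha> + \<alpha>) - w0 \<bullet> w3"
    using arg_cong[OF w(1), of "inner w0"] arg_cong[OF w(2), of "inner w0"] arg_cong[OF w(3), of "inner w0"]
    by (simp_all add: inner_diff_right inner_add_right i)
  have k: "k * (1 + \<alpha>) = 2 * \<alpha>"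
    using alpha_greater[OF c0] by (simp add: k_def)
  show *: "k\<^sup>2 + k = 1"
    using recurrence_five_cycle[OF k alpha_less g(1,2)] g(3) i by simp
  \<comment> \<open>Here \<open>\<alpha> = k / (2 - k)\<close>, and
    \<open>5 * k = (1 + 2 * k) * (2 - k)\<close> is the golden equation again.\<close>
  have "(5 * \<alpha> - 1 - 2 * k) * (2 - k) = 0"
    using k * by algebra
  moreover have "k \<noteq> 2" using * by auto
  ultimately show "5 * \<alpha> = 1 + 2 * k" by simp
qed

lemma tri_sym: "tri v w x \<Longrightarrow> tri v x w"
  unfolding tri_def using corner_sym by blast

text \<open>In a triangle the two neighbours of \<open>v\<close> are also neighbours of each other,
  which is why this locale has equal cosines; any vertex may serve as apex.\<close>

lemma tri_rot: 
  assumes "tri v w x" shows "tri w v x"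
proof -
  obtain f where f: "corner f v w x" using assms by (auto simp: tri_def)
  have "v \<noteq> x" using f corner_unit[OF f] alpha_less by (auto simp: corner_def)
  then have "corner f w v x"
    using f corner_inner[OF f] by (simp add: corner_def inner_commute)
  then show ?thesis by (auto simp: tri_def)
qed

lemma tri_flip:
  assumes "tri v w x" shows "tri v x (k *\<^sub>R (v + x) - w)"
proof -
  obtain f where f: "corner f v w x" using assms by (auto simp: tri_def)
  obtain g y where g: "corner g v x y" "y \<noteq> w" using corner_next[OF f] by blast
  then have "y = k *\<^sub>R (v + x) - w"
    using corner_flip[OF corner_sym[OF f] g(1)] by (simp add: k_def)
  then show ?thesis using g by (auto simp: tri_def)
qed

lemma tri_lin_comb_flip:
  assumes "tri (lin_comb a b c i j l) (lin_comb a b c i' j' l') (lin_comb a b c i'' j'' l'')"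
    and "r = k * (i + i'') - i'" "s = k * (j + j'') - j'" "t = k * (l + l'') - l'"
  shows "tri (lin_comb a b c i j l) (lin_comb a b c i'' j'' l'') (lin_comb a b c r s t)"
  using tri_flip[OF assms(1)] by (simp add: lin_comb_arith assms(2-4))

text \<open>
  The flips are linear, so reaching the antipodal triangle once makes the set of generated
  vertices centrally symmetric.
\<close>

lemma tri_negate:
  assumes "tri a b c" shows "tri (- a) (- b) (- c)"
proof -
  have kk: "k * k = 1 - k" using k_golden[OF assms] by (simp add: power2_eq_square)
  note flip = tri_lin_comb_flip[where a = a and b = b and c = c]
  have 1: "tri (lin_comb a b c 0 1 0) (lin_comb a b c 1 0 0) (lin_comb a b c 0 0 1)"
    using tri_rot[OF assms] by (simp add: lin_comb_def)
  have 2: "tri (lin_comb a b c 0 1 0) (lin_comb a b c 0 0 1) (lin_comb a b c (-1) k k)"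
    by (rule flip[OF 1]) auto
  have 3: "tri (lin_comb a b c 0 1 0) (lin_comb a b c (-1) k k) (lin_comb a b c (-k) 1 (-k))"
    by (rule flip[OF 2]) (auto simp: algebra_simps kk)
  have 4: "tri (lin_comb a b c (-1) k k) (lin_comb a b c (-k) 1 (-k)) (lin_comb a b c (-1) 0 0)"
    by (rule flip[OF tri_rot[OF 3]]) (auto simp: algebra_simps kk)
  have 5: "tri (lin_comb a b c (-1) k k) (lin_comb a b c (-1) 0 0) (lin_comb a b c (-k) (-k) 1)"
    by (rule flip[OF 4]) (auto simp: algebra_simps kk)
  have 6: "tri (lin_comb a b c (-1) 0 0) (lin_comb a b c (-k) (-k) 1) (lin_comb a b c 0 (-1) 0)"
    by (rule flip[OF tri_rot[OF 5]]) (auto simp: algebra_simps kk)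
  have 7: "tri (lin_comb a b c (-1) 0 0) (lin_comb a b c 0 (-1) 0) (lin_comb a b c 0 0 (-1))"
    by (rule flip[OF 6]) (auto simp: algebra_simps kk)
  then show ?thesis by (simp add: lin_comb_def)
qed

lemma half_subset:
  assumes "tri a b c" shows "set (half_icosahedron k a b c) \<subseteq> V"
proof -
  have mem: "v \<in> V" if "tri w x v" for v w x
    using that corner_mem by (auto simp: tri_def)
  have "lin_comb a b c 1 0 0 \<in> V" "lin_comb a b c 0 1 0 \<in> V" "lin_comb a b c 0 0 1 \<in> V"
    using assms corner_mem by (auto simp: tri_def lin_comb_def)
  moreover have "lin_comb a b c (-1) k k \<in> V"
    using mem[OF tri_flip[OF tri_rot[OF assms]]] by (simp add: lin_comb_def algebra_simps)
  moreover have "lin_comb a b c k (-1) k \<in> V"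
    using mem[OF tri_flip[OF assms]] by (simp add: lin_comb_def algebra_simps)
  moreover have "lin_comb a b c k k (-1) \<in> V"
    using mem[OF tri_flip[OF tri_sym[OF assms]]] by (simp add: lin_comb_def algebra_simps)
  ultimately show ?thesis by (simp add: half_icosahedron_def)
qed

lemma vertices_icosahedral:
  assumes "card V = 12"
  shows "uminus ` V = V"
    and "(\<Sum>p\<in>V. (x \<bullet> p) ^ 2) = 12 / 3 * (x \<bullet> x)"
    and "(\<Sum>p\<in>V. (x \<bullet> p) ^ 4) = 12 / 5 * (x \<bullet> x)\<^sup>2"
proof -
  obtain v where v: "v \<in> V" using assms by fastforce
  have "{f \<in> Fs. v \<in> f} \<noteq> {}" using degree[OF v] by force
  then obtain f a b c where f: "corner f a b c"
    using corner_exists by blast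
  then have t: "tri a b c" by (auto simp: tri_def)
  define L where "L = half_icosahedron k a b c @ map uminus (half_icosahedron k a b c)"
  note design = half_icosahedron_design[OF k_golden[OF t], of a b c, folded L_def]
  have i: "a \<bullet> a = 1" "b \<bullet> b = 1" "c \<bullet> c = 1" "a \<bullet> b = \<alpha>" "b \<bullet> c = \<alpha>" "a \<bullet> c = \<alpha>"
    using corner_unit[OF f] corner_inner[OF f] f inner_commute unfolding corner_def by metis+
  have "set L \<subseteq> V"
    using half_subset[OF t] half_subset[OF tri_negate[OF t]]
    by (simp add: L_def half_icosahedron_negate)
  moreover have "card (set L) = 12"
    using distinct_card[OF design(1)[OF i]] by (simp add: L_def half_icosahedron_def)
  ultimately have V: "V = set L"
    using assms card_subset_eq[of V "set L"] by (metis card.infinite zero_neq_numeral)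
  show "uminus ` V = V"
    by (simp add: V L_def image_Un image_image Un_commute)
  show "(\<Sum>p\<in>V. (x \<bullet> p) ^ 2) = 12 / 3 * (x \<bullet> x)" "(\<Sum>p\<in>V. (x \<bullet> p) ^ 4) = 12 / 5 * (x \<bullet> x)\<^sup>2"
    using design(2,3)[OF i] unfolding V by simp_all
qed

end

subsection \<open>The dodecahedron\<close>

text \<open>One vertex from each antipodal pair: \<open>a\<close>, its three neighbours, and the six
  vertices two steps away from \<open>a\<close>.\<close>

definition half_dodecahedron :: "real \<Rightarrow> 'a::real_vector \<Rightarrow> 'a \<Rightarrow> 'a \<Rightarrow> 'a list" where
  "half_dodecahedron \<phi> a b c = [lin_comb a b c 1 0 0, lin_comb a b c 0 1 0, lin_comb a b c 0 0 1,
    lin_comb a b c (2 * \<phi> - 1) (-1) (-1), lin_comb a b c (-\<phi>) 1 \<phi>, lin_comb a b c (-\<phi>) \<phi> 1,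
    lin_comb a b c 2 (1 - \<phi>) (-\<phi>), lin_comb a b c 2 (-\<phi>) (1 - \<phi>),
    lin_comb a b c (\<phi> - 1) (-1) (\<phi> - 1), lin_comb a b c (\<phi> - 1) (\<phi> - 1) (-1)]"

lemma half_dodecahedron_negate:
  "half_dodecahedron \<phi> (- a) (- b) (- c) = map uminus (half_dodecahedron \<phi> a b c)"
  by (simp add: half_dodecahedron_def lin_comb_def)

lemma golden_ratio_bounds:
  fixes \<phi> :: real
  assumes "\<phi>\<^sup>2 = \<phi> + 1" "\<phi> > 0"
  shows "1.618 < \<phi>" "\<phi> < 1.6181"
proof -
  have "(\<phi> - 1.618) * (\<phi> + 0.618) > 0" "(\<phi> - 1.6181) * (\<phi> + 0.6181) < 0"
    using assms(1) by (simp_all add: algebra_simps power2_eq_square)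
  then show "1.618 < \<phi>" "\<phi> < 1.6181"
    using assms(2) by (auto simp: zero_less_mult_iff mult_less_0_iff)
qed

lemma half_dodecahedron_design:
  fixes a b c x :: "real^3"
  assumes phi: "\<phi>\<^sup>2 = \<phi> + 1" "\<phi> > 0" and al: "\<alpha> = (2 * \<phi> - 1) / 3"
    and unit: "a \<bullet> a = 1" "b \<bullet> b = 1" "c \<bullet> c = 1"
    and angle: "a \<bullet> b = \<alpha>" "b \<bullet> c = 1 / 3" "a \<bullet> c = \<alpha>"
  defines "L \<equiv> half_dodecahedron \<phi> a b c @ map uminus (half_dodecahedron \<phi> a b c)"
  shows "distinct L"
    and "(\<Sum>p\<in>set L. (x \<bullet> p) ^ 2) = 20 / 3 * (x \<bullet> x)"
    and "(\<Sum>p\<in>set L. (x \<bullet> p) ^ 4) = 20 / 5 * (x \<bullet> x)\<^sup>2"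
proof -
  have kk: "\<phi> * \<phi> = \<phi> + 1" "\<phi> * (\<phi> * r) = \<phi> * r + r" for r
    using phi by (simp_all add: power2_eq_square, algebra+)
  have i: "a \<bullet> a = 1" "b \<bullet> b = 1" "c \<bullet> c = 1" "a \<bullet> b = \<alpha>" "b \<bullet> c = 1 / 3" "a \<bullet> c = \<alpha>"
    "b \<bullet> a = \<alpha>" "c \<bullet> b = 1 / 3" "c \<bullet> a = \<alpha>"
    using unit angle by (simp_all only: inner_commute)
  have "27 * gram3 a b c = 24 - 12 * (2 * \<phi> - 1)\<^sup>2 / 3"
    unfolding gram3_def i al by (simp add: field_simps power2_eq_square)
  also have "\<dots> = 4"
    using phi(1) by algebra
  finally have gram: "gram3 a b c \<noteq> 0" by auto
  obtain y where "y \<bullet> a = 1" "y \<bullet> b = 10" "y \<bullet> c = 100"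
    using dual_vector[OF gram] .
  then have "distinct (map (inner y) L)"
    using golden_ratio_bounds[OF phi] by (auto simp: L_def half_dodecahedron_def inner_lin_comb)
  then show dL: "distinct L" by (simp add: distinct_map)
  have sumL: "(\<Sum>p\<in>set L. f p) = sum_list (map f L)" for f :: "real^3 \<Rightarrow> 'z::comm_monoid_add"
    by (rule sum.distinct_set_conv_list[OF dL])
  have T: "(\<Sum>p\<in>set L. (a \<bullet> p) *\<^sub>R p) = lin_comb a b c (20 / 3) 0 0" "(\<Sum>p\<in>set L. (b \<bullet> p) *\<^sub>R p) = lin_comb a b c 0 (20 / 3) 0"
    "(\<Sum>p\<in>set L. (c \<bullet> p) *\<^sub>R p) = lin_comb a b c 0 0 (20 / 3)"
    unfolding sumL by (simp_all add: L_def half_dodecahedron_def inner_lin_comb lin_comb_arith i al algebra_simps kk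
        add_divide_distrib diff_divide_distrib)
  show *: "(\<Sum>p\<in>set L. (x \<bullet> p) ^ 2) = 20 / 3 * (x \<bullet> x)"
    using second_moment_of_frame[OF _ gram, of "set L" "20 / 3"] T by (simp add: lin_comb_def)
  \<comment> \<open>The factor is \<open>(20 / 5) / (20 / 3)^2\<close>.\<close>
  have "20 / 5 * (x \<bullet> x)\<^sup>2 = (\<Sum>p\<in>set L. (x \<bullet> p) ^ 2)\<^sup>2 * (9 / 100)"
    unfolding * by (simp add: power2_eq_square)
  also have "\<dots> = (\<Sum>p\<in>set L. (x \<bullet> p) ^ 4)"
    unfolding sumL
    by (simp add: L_def half_dodecahedron_def inner_lin_comb power2_eq_square power4_eq_xxxx algebra_simps kk)
  finally show "(\<Sum>p\<in>set L. (x \<bullet> p) ^ 4) = 20 / 5 * (x \<bullet> x)\<^sup>2" ..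
qed

text \<open>
  In a regular pentagon each diagonal is parallel to a side and \<open>\<phi>\<close> times as long, so the
  vertices \<open>w, v, w'\<close> are followed by \<open>w + \<phi> *\<^sub>R (w' - v)\<close>.
\<close>

locale dodecahedral_figures = vertex_figures V Fs \<alpha> \<beta> 3 for V Fs \<alpha> \<beta> +
  fixes \<phi> :: real
  assumes golden: "\<phi>\<^sup>2 = \<phi> + 1" "\<phi> > 0"
    and diagonal: "1 - \<beta> = \<phi>\<^sup>2 * (1 - \<alpha>)"
    and pentagon: "f \<in> Fs \<Longrightarrow> {v, w, w'} \<subseteq> f \<Longrightarrow> w \<noteq> w' \<Longrightarrow> w \<bullet> v = \<alpha> \<Longrightarrow> w' \<bullet> v = \<alpha> \<Longrightarrow>
      w + \<phi> *\<^sub>R (w' - v) \<in> f \<and> (w + \<phi> *\<^sub>R (w' - v)) \<bullet> w' = \<alpha>"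
begin

definition is_corner where "is_corner v w w' \<longleftrightarrow> (\<exists>f. corner f v w w')"

lemma is_corner_sym: "is_corner v w x \<Longrightarrow> is_corner v x w"
  unfolding is_corner_def using corner_sym by blast

text \<open>One step along the pentagon from \<open>v\<close> to \<open>w'\<close>. The vertex
  supplied by the diagonal rule is not \<open>v\<close> again, as this would force
  \<open>\<alpha> > 1\<close>.\<close>

lemma is_corner_pentagon:
  assumes "is_corner v w w'" shows "is_corner w' v (w + \<phi> *\<^sub>R (w' - v))"
proof -
  obtain f where f: "corner f v w w'" using assms by (auto simp: is_corner_def)
  let ?y = "w + \<phi> *\<^sub>R (w' - v)"
  have y: "?y \<in> f" "?y \<bullet> w' = \<alpha>"
    using pentagon[of f v w w'] f by (auto simp: corner_def)
  have "?y \<noteq> v"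
  proof
    assume "?y = v"
    from arg_cong[OF this, of "inner v"] have "w \<bullet> v = 1 + \<phi> * (1 - \<alpha>)"
      using f corner_unit[OF f]
      by (simp add: corner_def inner_add_right inner_diff_right inner_commute[of v w] inner_commute[of v w'] algebra_simps)
    moreover have "\<phi> * (1 - \<alpha>) > 0" using golden(2) alpha_less by simp
    ultimately show False using f alpha_less by (simp add: corner_def)
  qed
  then have "corner f w' v ?y"
    using f y by (simp add: corner_def inner_commute)
  then show ?thesis by (auto simp: is_corner_def)
qed

text \<open>Let \<open>g\<close> and \<open>h\<close> be the facets across the two sides of the
  corner. Only \<open>f\<close>, \<open>g\<close>, \<open>h\<close> meet at \<open>v\<close>, so the
  facet across the other side of \<open>g\<close> is \<open>h\<close>, and the two share the third
  neighbour \<open>x\<close>.\<close>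

lemma three_neighbours:
  assumes "corner f v w w'"
  obtains x g h where "corner g v w x" "corner h v w' x" "x \<noteq> w" "x \<noteq> w'"
proof -
  note cd = corner_def
  have v: "v \<in> V" using corner_mem assms by blast
  obtain g x where g: "corner g v w x" "g \<noteq> f" "x \<noteq> w'"
    using corner_next[OF corner_sym[OF assms]] by blast
  obtain h y where h: "corner h v w' y" "h \<noteq> f" "y \<noteq> w"
    using corner_next[OF assms] by blast
  have xw: "x \<noteq> w" using g by (auto simp: cd)
  have "h \<noteq> g"
    using corner_uniq[OF g(1), of w'] h(1) g(3) assms by (auto simp: cd)
  obtain e z where e: "corner e v x z" "e \<noteq> g"
    using corner_next[OF g(1)] by blast
  have "e \<in> {f, g, h}"
    by (rule facets_at_vertex[OF v])
      (use corner_facet[OF assms] corner_facet[OF g(1)] corner_facet[OF h(1)] corner_facet[OF e(1)]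
        g(2) h(2) \<open>h \<noteq> g\<close> in auto)
  moreover have "e \<noteq> f"
    using corner_uniq[OF assms, of x] e(1) g(3) xw by (auto simp: cd)
  ultimately have "e = h" using e by auto
  then have "x = y"
    using corner_uniq[OF h(1), of x] e(1) g(3) by (auto simp: cd)
  then show ?thesis using that g h xw by blast
qed

text \<open>The three neighbours of \<open>v\<close> make equal angles with \<open>v\<close> and
  with one another, so their sum is a multiple of \<open>v\<close>, which determines the third from
  the other two. Its inner product with \<open>w\<close>, combined with \<open>diagonal\<close>,
  determines both cosines.\<close>

lemma third_neighbour:
  assumes "is_corner v w w'"
  shows "\<alpha> = (2 * \<phi> - 1) / 3" "\<beta> = 1 / 3" "is_corner v w ((2 * \<phi> - 1) *\<^sub>R v - w - w')"
proof -
  obtain f where f: "corner f v w w'" using assms by (auto simp: is_corner_def)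
  obtain x g h where g: "corner g v w x" and h: "corner h v w' x"
    using three_neighbours[OF f] .
  have i: "v \<bullet> v = 1" "w \<bullet> w = 1" "w' \<bullet> w' = 1" "x \<bullet> x = 1" "w \<bullet> v = \<alpha>" "w' \<bullet> v = \<alpha>" "x \<bullet> v = \<alpha>"
    "w \<bullet> w' = \<beta>" "w \<bullet> x = \<beta>" "w' \<bullet> x = \<beta>"
    using corner_unit[OF f] corner_unit[OF g] corner_inner[OF f] corner_inner[OF g] corner_inner[OF h] f g h
    unfolding corner_def by metis+
  have i': "v \<bullet> w = \<alpha>" "v \<bullet> w' = \<alpha>" "v \<bullet> x = \<alpha>" "w' \<bullet> w = \<beta>" "x \<bullet> w = \<beta>" "x \<bullet> w' = \<beta>"
    using i by (simp_all only: inner_commute)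
  note ii = i i' inner_add_left inner_add_right inner_diff_left inner_diff_right
  define s where "s = w + w' + x"
  have "\<phi>\<^sup>2 * (1 - \<alpha>) > 0" using golden(2) alpha_less by simp
  then have beta: "\<beta> < 1" using diagonal by simp
  \<comment> \<open>Both vectors are perpendicular to \<open>w - w'\<close> and to
    \<open>w' - x\<close>, and also to each other.\<close>
  have "v = 0 \<or> s - (3 * \<alpha>) *\<^sub>R v = 0"
  proof (rule perpendicular_to_pair[of _ "w - w'" "w' - x"])
    have "((w - w') \<bullet> (w - w')) * ((w' - x) \<bullet> (w' - x)) - ((w - w') \<bullet> (w' - x))\<^sup>2 = 3 * (1 - \<beta>)\<^sup>2"
      by (simp add: ii power2_eq_square algebra_simps)
    also have "\<dots> > 0" using beta by simp
    finally show "((w - w') \<bullet> (w - w')) * ((w' - x) \<bullet> (w' - x)) \<noteq> ((w - w') \<bullet> (w' - x))\<^sup>2" by simp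
  qed (simp_all add: s_def ii)
  then have s: "s = (3 * \<alpha>) *\<^sub>R v" using i(1) by auto
  have "1 + 2 * \<beta> = 3 * \<alpha>\<^sup>2"
    using arg_cong[OF s, of "inner w"] by (simp add: s_def ii power2_eq_square)
  then have "(1 - \<alpha>) * (3 + 3 * \<alpha> - 2 * \<phi>\<^sup>2) = 0"
    using diagonal by algebra
  then show al: "\<alpha> = (2 * \<phi> - 1) / 3"
    using alpha_less golden by simp
  have "3 * (1 - \<beta>) = (\<phi> + 1) * (4 - 2 * \<phi>)"
    using diagonal golden by (simp add: al field_simps)
  also have "\<dots> = 2" using golden by algebra
  finally show "\<beta> = 1 / 3" by simp
  have "3 * \<alpha> = 2 * \<phi> - 1" using al by simp
  then have "s = (2 * \<phi> - 1) *\<^sub>R v" using s by (simp only:)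
  then have "x = (2 * \<phi> - 1) *\<^sub>R v - w - w'"
    by (simp add: s_def eq_diff_eq add_ac)
  then show "is_corner v w ((2 * \<phi> - 1) *\<^sub>R v - w - w')"
    using g by (auto simp: is_corner_def)
qed

lemma is_corner_lin_comb_third:
  assumes "is_corner (lin_comb a b c i j l) (lin_comb a b c i' j' l') (lin_comb a b c i'' j'' l'')"
    and "r = (2 * \<phi> - 1) * i - i' - i''" "s = (2 * \<phi> - 1) * j - j' - j''"
      "t = (2 * \<phi> - 1) * l - l' - l''"
  shows "is_corner (lin_comb a b c i j l) (lin_comb a b c i' j' l') (lin_comb a b c r s t)"
  using third_neighbour(3)[OF assms(1)] by (simp add: lin_comb_arith assms(2-4))

lemma is_corner_lin_comb_pentagon:
  assumes "is_corner (lin_comb a b c i j l) (lin_comb a b c i' j' l') (lin_comb a b c i'' j'' l'')"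
    and "r = i' + \<phi> * (i'' - i)" "s = j' + \<phi> * (j'' - j)" "t = l' + \<phi> * (l'' - l)"
  shows "is_corner (lin_comb a b c i'' j'' l'') (lin_comb a b c i j l) (lin_comb a b c r s t)"
  using is_corner_pentagon[OF assms(1)] by (simp add: lin_comb_arith assms(2-4))

text \<open>A path of corners leads to the antipodal one: three times, a change of facet at the
  current vertex is followed by two steps along the new pentagon. The rules being linear, the
  generated vertices then come in antipodal pairs.\<close>

lemma is_corner_negate:
  assumes "is_corner a b c" shows "is_corner (- a) (- b) (- c)"
proof -
  have kk: "\<phi> * \<phi> = \<phi> + 1" "\<phi> * (\<phi> * r) = \<phi> * r + r" for r
    using golden by (simp_all add: power2_eq_square, algebra+)
  note pent = is_corner_lin_comb_pentagon[where a = a and b = b and c = c]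
  note third = is_corner_lin_comb_third[where a = a and b = b and c = c]
  have 0: "is_corner (lin_comb a b c 1 0 0) (lin_comb a b c 0 1 0) (lin_comb a b c 0 0 1)"
    using assms by (simp add: lin_comb_def)
  have 1: "is_corner (lin_comb a b c 1 0 0) (lin_comb a b c 0 1 0) (lin_comb a b c (2 * \<phi> - 1) (-1) (-1))"
    by (rule third[OF 0]) auto
  have 2: "is_corner (lin_comb a b c (2 * \<phi> - 1) (-1) (-1)) (lin_comb a b c 1 0 0) (lin_comb a b c 2 (1 - \<phi>) (-\<phi>))"
    by (rule pent[OF 1]) (auto simp: algebra_simps kk)
  have 3: "is_corner (lin_comb a b c 2 (1 - \<phi>) (-\<phi>)) (lin_comb a b c (2 * \<phi> - 1) (-1) (-1)) (lin_comb a b c (\<phi> - 1) (\<phi> - 1) (-1))"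
    by (rule pent[OF 2]) (auto simp: algebra_simps kk)
  have 4: "is_corner (lin_comb a b c 2 (1 - \<phi>) (-\<phi>)) (lin_comb a b c (2 * \<phi> - 1) (-1) (-1)) (lin_comb a b c \<phi> (-1) (-\<phi>))"
    by (rule third[OF 3]) (auto simp: algebra_simps kk)
  have 5: "is_corner (lin_comb a b c \<phi> (-1) (-\<phi>)) (lin_comb a b c 2 (1 - \<phi>) (-\<phi>)) (lin_comb a b c \<phi> (-\<phi>) (-1))"
    by (rule pent[OF 4]) (auto simp: algebra_simps kk)
  have 6: "is_corner (lin_comb a b c \<phi> (-\<phi>) (-1)) (lin_comb a b c \<phi> (-1) (-\<phi>)) (lin_comb a b c 2 (-\<phi>) (1 - \<phi>))"
    by (rule pent[OF 5]) (auto simp: algebra_simps kk)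
  have 7: "is_corner (lin_comb a b c \<phi> (-\<phi>) (-1)) (lin_comb a b c \<phi> (-1) (-\<phi>)) (lin_comb a b c 0 (-1) 0)"
    by (rule third[OF 6]) (auto simp: algebra_simps kk)
  have 8: "is_corner (lin_comb a b c 0 (-1) 0) (lin_comb a b c \<phi> (-\<phi>) (-1)) (lin_comb a b c (-1) 0 0)"
    by (rule pent[OF 7]) (auto simp: algebra_simps kk)
  have 9: "is_corner (lin_comb a b c (-1) 0 0) (lin_comb a b c 0 (-1) 0) (lin_comb a b c 0 0 (-1))"
    by (rule pent[OF 8]) (auto simp: algebra_simps kk)
  then show ?thesis by (simp add: lin_comb_def)
qed

lemma half_dodecahedron_subset:
  assumes "is_corner a b c" shows "set (half_dodecahedron \<phi> a b c) \<subseteq> V"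
proof -
  have mem: "v \<in> V" if "is_corner w x v" for v w x
    using that corner_mem by (auto simp: is_corner_def)
  have kk: "\<phi> * \<phi> = \<phi> + 1" "\<phi> * (\<phi> * r) = \<phi> * r + r" for r
    using golden by (simp_all add: power2_eq_square, algebra+)
  note pent = is_corner_lin_comb_pentagon[where a = a and b = b and c = c]
  note third = is_corner_lin_comb_third[where a = a and b = b and c = c]
  have 1: "is_corner (lin_comb a b c 1 0 0) (lin_comb a b c 0 1 0) (lin_comb a b c 0 0 1)"
    using assms by (simp add: lin_comb_def)
  note 2 = is_corner_sym[OF 1]
  have "lin_comb a b c 1 0 0 \<in> V" "lin_comb a b c 0 1 0 \<in> V" "lin_comb a b c 0 0 1 \<in> V"
    using assms corner_mem by (auto simp: is_corner_def lin_comb_def)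
  moreover have 3: "is_corner (lin_comb a b c 1 0 0) (lin_comb a b c 0 1 0) (lin_comb a b c (2 * \<phi> - 1) (-1) (-1))"
    "is_corner (lin_comb a b c 1 0 0) (lin_comb a b c 0 0 1) (lin_comb a b c (2 * \<phi> - 1) (-1) (-1))"
    by (auto intro!: third[OF 1] third[OF 2])
  moreover have "is_corner (lin_comb a b c (2 * \<phi> - 1) (-1) (-1)) (lin_comb a b c 1 0 0) (lin_comb a b c 2 (1 - \<phi>) (-\<phi>))"
    "is_corner (lin_comb a b c (2 * \<phi> - 1) (-1) (-1)) (lin_comb a b c 1 0 0) (lin_comb a b c 2 (-\<phi>) (1 - \<phi>))"
    by (rule pent[OF 3(1)] pent[OF 3(2)]; simp add: algebra_simps kk)+
  moreover have 4: "is_corner (lin_comb a b c 0 0 1) (lin_comb a b c 1 0 0) (lin_comb a b c (-\<phi>) 1 \<phi>)"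
    "is_corner (lin_comb a b c 0 1 0) (lin_comb a b c 1 0 0) (lin_comb a b c (-\<phi>) \<phi> 1)"
    by (rule pent[OF 1] pent[OF 2]; simp)+
  moreover have "is_corner (lin_comb a b c 0 0 1) (lin_comb a b c 1 0 0) (lin_comb a b c (\<phi> - 1) (-1) (\<phi> - 1))"
    "is_corner (lin_comb a b c 0 1 0) (lin_comb a b c 1 0 0) (lin_comb a b c (\<phi> - 1) (\<phi> - 1) (-1))"
    by (rule third[OF 4(1)] third[OF 4(2)]; simp add: algebra_simps kk)+
  ultimately show ?thesis by (auto simp: half_dodecahedron_def dest: mem)
qed

lemma vertices_dodecahedral:
  assumes "card V = 20"
  shows "uminus ` V = V"
    and "(\<Sum>p\<in>V. (x \<bullet> p) ^ 2) = 20 / 3 * (x \<bullet> x)"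
    and "(\<Sum>p\<in>V. (x \<bullet> p) ^ 4) = 20 / 5 * (x \<bullet> x)\<^sup>2"
proof -
  obtain v where v: "v \<in> V" using assms by fastforce
  have "{f \<in> Fs. v \<in> f} \<noteq> {}" using degree[OF v] by force
  then obtain f a b c where f: "corner f a b c"
    using corner_exists by blast
  then have t: "is_corner a b c" by (auto simp: is_corner_def)
  define L where "L = half_dodecahedron \<phi> a b c @ map uminus (half_dodecahedron \<phi> a b c)"
  note design = half_dodecahedron_design[OF golden third_neighbour(1)[OF t], of a b c, folded L_def]
  have i: "a \<bullet> a = 1" "b \<bullet> b = 1" "c \<bullet> c = 1" "a \<bullet> b = \<alpha>" "b \<bullet> c = 1 / 3" "a \<bullet> c = \<alpha>"
    using corner_unit[OF f] corner_inner[OF f] f inner_commute third_neighbour(2)[OF t]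
    unfolding corner_def by metis+
  have "set L \<subseteq> V"
    using half_dodecahedron_subset[OF t] half_dodecahedron_subset[OF is_corner_negate[OF t]]
    by (simp add: L_def half_dodecahedron_negate)
  moreover have "card (set L) = 20"
    using distinct_card[OF design(1)[OF i]] by (simp add: L_def half_dodecahedron_def)
  ultimately have V: "V = set L"
    using assms card_subset_eq[of V "set L"] by (metis card.infinite zero_neq_numeral)
  show "uminus ` V = V"
    by (simp add: V L_def image_Un image_image Un_commute)
  show "(\<Sum>p\<in>V. (x \<bullet> p) ^ 2) = 20 / 3 * (x \<bullet> x)" "(\<Sum>p\<in>V. (x \<bullet> p) ^ 4) = 20 / 5 * (x \<bullet> x)\<^sup>2"
    using design(2,3)[OF i] unfolding V by simp_all
qed

end

subsection \<open>Regular polygons\<close>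

text \<open>The functional \<open>d\<close> supports the hull along \<open>T\<close>: the affine
  hull of \<open>T\<close> lies in the hyperplane, the remaining points strictly on one
  side.\<close>

lemma face_of_convex_hull_supporting:
  fixes S :: "'a::euclidean_space set"
  assumes "finite S" "T \<subseteq> S" "\<And>x. x \<in> T \<Longrightarrow> d \<bullet> x = e" "\<And>x. x \<in> S - T \<Longrightarrow> d \<bullet> x < e"
  shows "(convex hull T) face_of (convex hull S)"
proof (rule face_of_convex_hulls[OF assms(1,2)])
  have "affine hull T \<subseteq> {x. d \<bullet> x = e}"
    using assms(3) by (intro hull_minimal affine_hyperplane) auto
  moreover have "convex hull (S - T) \<subseteq> {x. d \<bullet> x < e}"
    using assms(4) by (intro hull_minimal convex_halfspace_lt) auto
  ultimately show "affine hull T \<inter> convex hull (S - T) = {}" by fastforce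
qed

text \<open>For \<open>t = 2 * pi / 5\<close> the angles \<open>2 * t\<close> and
  \<open>3 * t\<close> have the same cosine, so \<open>4 * c^3 - 3 * c = 2 * c^2 - 1\<close>. Apart
  from the root 1 this is a quadratic, and \<open>c > 0\<close> selects its root.\<close>

lemma cos_sin_fifth:
  defines "\<phi> \<equiv> (1 + sqrt 5) / 2"
  shows "cos (2 * pi * 1 / 5) = (\<phi> - 1) / 2" "cos (2 * pi * 2 / 5) = - \<phi> / 2"
    "cos (2 * pi * 3 / 5) = - \<phi> / 2" "cos (2 * pi * 4 / 5) = (\<phi> - 1) / 2"
    "sin (2 * pi * 2 / 5) = (\<phi> - 1) * sin (2 * pi * 1 / 5)"
    "sin (2 * pi * 3 / 5) = - (\<phi> - 1) * sin (2 * pi * 1 / 5)"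
    "sin (2 * pi * 4 / 5) = - sin (2 * pi * 1 / 5)"
proof -
  define c where "c = cos (2 * pi * 1 / 5)"
  define t :: real where "t = 2 * pi * 1 / 5"
  have c0: "c > 0" unfolding c_def by (rule cos_gt_zero) auto
  have c2: "cos (2 * pi * 2 / 5) = 2 * c\<^sup>2 - 1"
    using cos_double_cos[of t] by (simp add: c_def t_def)
  have s2: "sin (2 * pi * 2 / 5) = 2 * c * sin (2 * pi * 1 / 5)"
    using sin_double[of t] by (simp add: c_def t_def)
  have e3: "2 * pi * 3 / 5 = 2 * pi - 2 * pi * 2 / 5" and e4: "2 * pi * 4 / 5 = 2 * pi - 2 * pi * 1 / 5"
    by (simp_all add: field_simps)
  have c3: "cos (2 * pi * 3 / 5) = cos (2 * pi * 2 / 5)" "cos (2 * pi * 4 / 5) = c"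
    "sin (2 * pi * 3 / 5) = - sin (2 * pi * 2 / 5)" "sin (2 * pi * 4 / 5) = - sin (2 * pi * 1 / 5)"
    unfolding e3 e4 c_def by (simp_all only: cos_2pi_minus sin_2pi_minus)
  have "cos (3 * t) = 4 * c ^ 3 - 3 * c"
    using cos_treble_cos[of t] by (simp add: c_def t_def)
  moreover have "cos (3 * t) = cos (2 * pi * 3 / 5)" by (simp add: t_def)
  ultimately have "(c - 1) * (4 * c\<^sup>2 + 2 * c - 1) = 0"
    unfolding c3 c2 by algebra
  moreover have "c \<noteq> 1"
  proof
    assume "c = 1"
    moreover have "c < cos 0" unfolding c_def by (rule cos_monotone_0_pi) auto
    ultimately show False by simp
  qed
  ultimately have q: "4 * c\<^sup>2 + 2 * c - 1 = 0" by simp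
  then have "(4 * c + 1 - sqrt 5) * (4 * c + 1 + sqrt 5) = 0"
    by (simp add: algebra_simps power2_eq_square)
  moreover have "4 * c + 1 + sqrt 5 > 0" using c0 by (simp add: add_pos_pos)
  ultimately have "4 * c + 1 - sqrt 5 = 0" by simp
  then have c: "c = (\<phi> - 1) / 2" by (simp add: \<phi>_def field_simps)
  have phi: "2 * c\<^sup>2 - 1 = - \<phi> / 2"
  proof -
    have "\<phi> = 2 * c + 1" using c by simp
    then show ?thesis using q by (simp only:) (simp add: field_simps)
  qed
  have c': "2 * c = \<phi> - 1" using c by simp
  show "cos (2 * pi * 1 / 5) = (\<phi> - 1) / 2"
    unfolding c_def[symmetric] by (rule c)
  show "cos (2 * pi * 4 / 5) = (\<phi> - 1) / 2"
    unfolding c3 by (rule c)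
  show "cos (2 * pi * 2 / 5) = - \<phi> / 2" "cos (2 * pi * 3 / 5) = - \<phi> / 2"
    unfolding c3 c2 by (rule phi)+
  show "sin (2 * pi * 2 / 5) = (\<phi> - 1) * sin (2 * pi * 1 / 5)"
    "sin (2 * pi * 3 / 5) = - (\<phi> - 1) * sin (2 * pi * 1 / 5)"
    unfolding c3 s2 c' by (simp_all add: algebra_simps)
  show "sin (2 * pi * 4 / 5) = - sin (2 * pi * 1 / 5)"
    unfolding c3 ..
qed

text \<open>Rotating the frame in its plane brings a given vertex to index 0, so a polygon need only
  be examined at that vertex.\<close>

lemma regular_polygon_from_vertex:
  fixes F :: "'a::euclidean_space set"
  assumes "regular_polygon p r F" "v extreme_point_of F"
  obtains a u w where "norm u = 1" "norm w = 1" "u \<bullet> w = 0" "v = a + r *\<^sub>R u"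
    "F = convex hull ((\<lambda>k. a + (r * cos (2 * pi * real k / real p)) *\<^sub>R u
                + (r * sin (2 * pi * real k / real p)) *\<^sub>R w) ` {..<p})"
proof -
  obtain a u w where p: "3 \<le> p" "0 < r" and uw: "norm u = 1" "norm w = 1" "u \<bullet> w = 0" and
      F: "F = convex hull ((\<lambda>k. a + (r * cos (2 * pi * real k / real p)) *\<^sub>R u
                + (r * sin (2 * pi * real k / real p)) *\<^sub>R w) ` {..<p})"
    using assms(1) unfolding regular_polygon_def by blast
  define Q where "Q t = a + (r * cos (2 * pi * t / real p)) *\<^sub>R u + (r * sin (2 * pi * t / real p)) *\<^sub>R w" for t
  have FQ: "F = convex hull ((\<lambda>k. Q (real k)) ` {..<p})" unfolding F Q_def ..
  obtain k0 where k0: "k0 < p" "v = Q (real k0)"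
    using extreme_point_of_convex_hull assms(2) unfolding FQ by blast
  have per: "Q (t + real p) = Q t" for t
    using p by (simp add: Q_def add_divide_distrib distrib_left)
  have shift: "(\<lambda>k. Q (real k)) ` {..<p} = (\<lambda>k. Q (real k + real k0)) ` {..<p}"
  proof (intro equalityI image_subsetI)
    fix k assume "k \<in> {..<p}"
    show "Q (real k) \<in> (\<lambda>k. Q (real k + real k0)) ` {..<p}"
    proof (cases "k0 \<le> k")
      case True
      then show ?thesis using \<open>k \<in> {..<p}\<close>
        by (intro image_eqI[of _ _ "k - k0"]) (auto simp: of_nat_diff)
    next
      case False
      then have "real (k + p - k0) + real k0 = real k + real p" using k0 by (simp add: of_nat_diff)
      then show ?thesis using \<open>k \<in> {..<p}\<close> False k0 per[of "real k"]
        by (intro image_eqI[of _ _ "k + p - k0"]) auto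
    qed
  next
    fix k assume "k \<in> {..<p}"
    show "Q (real k + real k0) \<in> (\<lambda>k. Q (real k)) ` {..<p}"
    proof (cases "k + k0 < p")
      case True
      then show ?thesis by (intro image_eqI[of _ _ "k + k0"]) auto
    next
      case False
      then have "real (k + k0 - p) + real p = real k + real k0" by (simp add: of_nat_diff)
      then show ?thesis using \<open>k \<in> {..<p}\<close> False k0 per[of "real (k + k0 - p)"]
        by (intro image_eqI[of _ _ "k + k0 - p"]) auto
    qed
  qed
  define \<theta> where "\<theta> = 2 * pi * real k0 / real p"
  define u' w' where "u' = cos \<theta> *\<^sub>R u + sin \<theta> *\<^sub>R w" and "w' = cos \<theta> *\<^sub>R w - sin \<theta> *\<^sub>R u"
  have i: "u \<bullet> u = 1" "w \<bullet> w = 1" "u \<bullet> w = 0" "w \<bullet> u = 0"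
    using uw by (simp_all add: norm_eq_1 inner_commute)
  show thesis
  proof (rule that)
    show "norm u' = 1" "norm w' = 1" "u' \<bullet> w' = 0"
      by (simp_all add: u'_def w'_def norm_eq_1 inner_add_left inner_add_right inner_diff_left
          inner_diff_right i power2_eq_square[symmetric] mult.commute)
    show "v = a + r *\<^sub>R u'"
      by (simp add: k0 Q_def u'_def \<theta>_def scaleR_add_right)
    have "Q (t + real k0) = a + (r * cos (2 * pi * t / real p)) *\<^sub>R u' + (r * sin (2 * pi * t / real p)) *\<^sub>R w'" for t
    proof -
      have "2 * pi * (t + real k0) / real p = 2 * pi * t / real p + \<theta>"
        by (simp add: \<theta>_def add_divide_distrib distrib_left)
      then show ?thesis
        unfolding Q_def u'_def w'_def by (simp add: cos_add sin_add algebra_simps)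
    qed
    then show "F = convex hull ((\<lambda>k. a + (r * cos (2 * pi * real k / real p)) *\<^sub>R u'
                + (r * sin (2 * pi * real k / real p)) *\<^sub>R w') ` {..<p})"
      unfolding FQ shift by simp
  qed
qed

text \<open>Among points on a sphere each one is the unique maximiser of the functional given by its
  own radius vector.\<close>

lemma extreme_point_of_cospherical_hull:
  fixes S :: "'a::euclidean_space set"
  assumes "finite S" "\<And>x. x \<in> S \<Longrightarrow> norm (x - a) = r"
  shows "x extreme_point_of (convex hull S) \<longleftrightarrow> x \<in> S"
proof
  show "x \<in> S" if "x extreme_point_of (convex hull S)"
    using that by (rule extreme_point_of_convex_hull)
  assume x: "x \<in> S"
  have "(x - a) \<bullet> y < (x - a) \<bullet> x" if "y \<in> S - {x}" for y
  proof -
    define X Y where "X = x - a" and "Y = y - a"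
    have "X \<bullet> X = r\<^sup>2" "Y \<bullet> Y = r\<^sup>2"
      using assms(2) x that by (simp_all add: X_def Y_def power2_norm_eq_inner[symmetric])
    moreover have "(X - Y) \<bullet> (X - Y) > 0" using that by (auto simp: X_def Y_def)
    ultimately have "X \<bullet> Y < X \<bullet> X"
      by (simp add: inner_diff_left inner_diff_right inner_commute[of Y X])
    then have "(x - a) \<bullet> (y - a) < (x - a) \<bullet> (x - a)"
      unfolding X_def Y_def .
    then show ?thesis by (simp add: inner_diff_right)
  qed
  then have "(convex hull {x}) face_of (convex hull S)"
    using x by (intro face_of_convex_hull_supporting[OF assms(1), of _ "x - a" "(x - a) \<bullet> x"]) auto
  then show "x extreme_point_of (convex hull S)" by (simp add: face_of_singleton)
qed

text \<open>The side is exposed by the functional pointing from the centre \<open>a\<close> towards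
  its midpoint.\<close>

lemma side_face_of_cospherical_hull:
  fixes S :: "'a::euclidean_space set"
  assumes "finite S" "a + b \<in> S" "a + b' \<in> S" "b \<bullet> b = b' \<bullet> b'"
    and "\<And>x. a + x \<in> S \<Longrightarrow> x \<noteq> b \<Longrightarrow> x \<noteq> b' \<Longrightarrow> b \<bullet> x + b' \<bullet> x < b \<bullet> b + b \<bullet> b'"
  shows "(convex hull {a + b, a + b'}) face_of (convex hull S)"
proof (rule face_of_convex_hull_supporting[OF assms(1), of _ "b + b'" "(b + b') \<bullet> (a + b)"])
  show "(b + b') \<bullet> x < (b + b') \<bullet> (a + b)" if "x \<in> S - {a + b, a + b'}" for x
  proof -
    have "x - a \<noteq> b" "x - a \<noteq> b'" using that by auto
    then show ?thesis
      using assms(5)[of "x - a"] that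
      by (simp add: inner_add_left inner_add_right inner_diff_right inner_commute[of b' b])
  qed
qed (use assms(2-4) in \<open>auto simp: inner_add_left inner_add_right inner_commute[of b' b]\<close>)

text \<open>\<open>L\<close> and \<open>D\<close> are the squared lengths of a side and of the
  segment joining the two neighbours of \<open>v\<close>. Squares are used because inner products of
  vertices on a sphere are affine functions of them.\<close>

definition figure_at :: "'a::euclidean_space set \<Rightarrow> real \<Rightarrow> real \<Rightarrow> 'a \<Rightarrow> 'a \<Rightarrow> 'a \<Rightarrow> bool" where
  "figure_at F L D v w w' \<longleftrightarrow> w \<noteq> w' \<and> {x. x extreme_point_of F \<and> (norm (x - v))\<^sup>2 = L} = {w, w'} \<and>
    (norm (w - w'))\<^sup>2 = D \<and> (convex hull {v, w}) face_of F \<and> (convex hull {v, w'}) face_of F"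

lemma lessThan_3_5: "{..<3::nat} = {0, 1, 2}" "{..<5::nat} = {0, 1, 2, 3, 4}"
  by auto

lemma triangle_figure:
  fixes F :: "'a::euclidean_space set"
  assumes "regular_polygon 3 r F" "v extreme_point_of F"
  obtains w w' where "figure_at F (3 * r\<^sup>2) (3 * r\<^sup>2) v w w'"
proof -
  have r: "r > 0" using assms(1) by (simp add: regular_polygon_def)
  obtain a u t where uw: "norm u = 1" "norm t = 1" "u \<bullet> t = 0" "v = a + r *\<^sub>R u" and
    F: "F = convex hull ((\<lambda>k. a + (r * cos (2 * pi * real k / real 3)) *\<^sub>R u
                + (r * sin (2 * pi * real k / real 3)) *\<^sub>R t) ` {..<3})"
    using regular_polygon_from_vertex[OF assms] .
  define b0 b1 b2 where b: "b0 = r *\<^sub>R u" "b1 = (- r / 2) *\<^sub>R u + (r * (sqrt 3 / 2)) *\<^sub>R t"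
    "b2 = (- r / 2) *\<^sub>R u - (r * (sqrt 3 / 2)) *\<^sub>R t"
  have e4: "2 * pi * 2 / 3 = 2 * pi - 2 * pi / 3" by simp
  have cs: "cos (2 * pi * 1 / 3) = - 1 / 2" "sin (2 * pi * 1 / 3) = sqrt 3 / 2"
    "cos (2 * pi * 2 / 3) = - 1 / 2" "sin (2 * pi * 2 / 3) = - sqrt 3 / 2"
    unfolding e4 cos_2pi_minus sin_2pi_minus by (simp_all add: cos_120 sin_120)
  have F: "F = convex hull {a + b0, a + b1, a + b2}"
    unfolding F lessThan_3_5 image_insert image_empty of_nat_numeral of_nat_1 of_nat_0 cs b
    by (simp add: algebra_simps)
  have i: "u \<bullet> u = 1" "t \<bullet> t = 1" "u \<bullet> t = 0" "t \<bullet> u = 0"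
    using uw by (simp_all add: norm_eq_1 inner_commute)
  have tab: "b0 \<bullet> b0 = r\<^sup>2" "b1 \<bullet> b1 = r\<^sup>2" "b2 \<bullet> b2 = r\<^sup>2" "b0 \<bullet> b1 = - r\<^sup>2 / 2" "b0 \<bullet> b2 = - r\<^sup>2 / 2"
    "b1 \<bullet> b2 = - r\<^sup>2 / 2" "b1 \<bullet> b0 = - r\<^sup>2 / 2" "b2 \<bullet> b0 = - r\<^sup>2 / 2" "b2 \<bullet> b1 = - r\<^sup>2 / 2"
    by (simp_all add: b inner_add_left inner_add_right inner_diff_left inner_diff_right i
        power2_eq_square field_simps)
  have r2: "r\<^sup>2 > 0" using r by simp
  have "- r\<^sup>2 / 2 \<noteq> r\<^sup>2" using r2 by linarith
  then have ne: "b0 \<noteq> b1" "b0 \<noteq> b2" "b1 \<noteq> b2" using tab by metis+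
  have ext: "x extreme_point_of F \<longleftrightarrow> x \<in> {a + b0, a + b1, a + b2}" for x
    unfolding F by (rule extreme_point_of_cospherical_hull[of _ a r])
      (use r tab in \<open>auto simp: norm_eq_sqrt_inner\<close>)
  have v: "v = a + b0" by (simp add: uw b)
  have n2: "(norm (x - y))\<^sup>2 = x \<bullet> x + y \<bullet> y - 2 * (x \<bullet> y)" for x y :: 'a
    by (simp add: power2_norm_eq_inner inner_diff_left inner_diff_right inner_commute[of y x])
  have "figure_at F (3 * r\<^sup>2) (3 * r\<^sup>2) v (a + b1) (a + b2)"
    unfolding figure_at_def
  proof (intro conjI)
    show "{x. x extreme_point_of F \<and> (norm (x - v))\<^sup>2 = 3 * r\<^sup>2} = {a + b1, a + b2}"
      using r by (auto simp: ext v n2[of _ b0] tab)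
    show "(convex hull {v, a + b1}) face_of F" "(convex hull {v, a + b2}) face_of F"
      unfolding v F using r2 by (auto intro!: side_face_of_cospherical_hull simp: tab)
  qed (use ne in \<open>auto simp: n2 tab\<close>)
  then show thesis using that by blast
qed

text \<open>The facts about the two opposite vertices are mirror images of each other; both are
  given because either neighbour may later play the part of \<open>w\<close>.\<close>

lemma pentagon_figure:
  fixes F :: "'a::euclidean_space set"
  assumes "regular_polygon 5 r F" "v extreme_point_of F"
  defines "\<phi> \<equiv> (1 + sqrt 5) / 2"
  obtains w w' where "figure_at F (r\<^sup>2 * (3 - \<phi>)) (r\<^sup>2 * (2 + \<phi>)) v w w'"
    "w + \<phi> *\<^sub>R (w' - v) extreme_point_of F" "(norm (w + \<phi> *\<^sub>R (w' - v) - w'))\<^sup>2 = r\<^sup>2 * (3 - \<phi>)"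
    "w' + \<phi> *\<^sub>R (w - v) extreme_point_of F" "(norm (w' + \<phi> *\<^sub>R (w - v) - w))\<^sup>2 = r\<^sup>2 * (3 - \<phi>)"
proof -
  have r: "r > 0" using assms(1) by (simp add: regular_polygon_def)
  have phi: "\<phi> * \<phi> = \<phi> + 1" by (simp add: \<phi>_def field_simps)
  have phi': "\<phi> * (\<phi> * x) = \<phi> * x + x" for x
    using phi by algebra
  have "2 < sqrt 5" "sqrt 5 < 3" by (auto intro: real_less_rsqrt real_less_lsqrt)
  then have phi1: "1 < \<phi>" "\<phi> < 2" by (simp_all add: \<phi>_def)
  obtain a u t where uw: "norm u = 1" "norm t = 1" "u \<bullet> t = 0" "v = a + r *\<^sub>R u" and
    F: "F = convex hull ((\<lambda>k. a + (r * cos (2 * pi * real k / real 5)) *\<^sub>R u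
                + (r * sin (2 * pi * real k / real 5)) *\<^sub>R t) ` {..<5})"
    using regular_polygon_from_vertex[OF assms(1,2)] .
  define s where "s = sin (2 * pi * 1 / 5)"
  define b0 b1 b2 b3 b4 where b: "b0 = r *\<^sub>R u" "b1 = (r * ((\<phi> - 1) / 2)) *\<^sub>R u + (r * s) *\<^sub>R t"
    "b2 = (r * (- \<phi> / 2)) *\<^sub>R u + (r * ((\<phi> - 1) * s)) *\<^sub>R t"
    "b3 = (r * (- \<phi> / 2)) *\<^sub>R u + (r * (- (\<phi> - 1) * s)) *\<^sub>R t"
    "b4 = (r * ((\<phi> - 1) / 2)) *\<^sub>R u + (r * - s) *\<^sub>R t"
  note cs = cos_sin_fifth[folded \<phi>_def s_def]
  have F: "F = convex hull {a + b0, a + b1, a + b2, a + b3, a + b4}"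
    unfolding F lessThan_3_5 image_insert image_empty of_nat_numeral of_nat_1 of_nat_0 cs b s_def[symmetric]
    by (simp add: algebra_simps)
  have i: "u \<bullet> u = 1" "t \<bullet> t = 1" "u \<bullet> t = 0" "t \<bullet> u = 0"
    using uw by (simp_all add: norm_eq_1 inner_commute)
  have "s * s = 1 - ((\<phi> - 1) / 2)\<^sup>2"
    using sin_squared_eq[of "2 * pi * 1 / 5"] unfolding cs s_def[symmetric] by (simp add: power2_eq_square)
  also have "\<dots> = (2 + \<phi>) / 4" by (simp add: power2_eq_square field_simps phi)
  finally have ss: "s * s = (2 + \<phi>) / 4" "s * (s * x) = (2 + \<phi>) / 4 * x" for x
    by (simp, metis mult.assoc)
  define C D where "C = r\<^sup>2 * ((\<phi> - 1) / 2)" and "D = r\<^sup>2 * (- \<phi> / 2)"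
  have tab: "b0 \<bullet> b0 = r\<^sup>2" "b1 \<bullet> b1 = r\<^sup>2" "b2 \<bullet> b2 = r\<^sup>2" "b3 \<bullet> b3 = r\<^sup>2" "b4 \<bullet> b4 = r\<^sup>2"
    "b0 \<bullet> b1 = C" "b1 \<bullet> b2 = C" "b2 \<bullet> b3 = C" "b3 \<bullet> b4 = C" "b0 \<bullet> b4 = C"
    "b0 \<bullet> b2 = D" "b1 \<bullet> b3 = D" "b2 \<bullet> b4 = D" "b0 \<bullet> b3 = D" "b1 \<bullet> b4 = D"
    by (simp_all add: b inner_add_left inner_add_right inner_diff_left inner_diff_right i C_def D_def
        power2_eq_square field_simps ss phi phi')
  have tab': "b1 \<bullet> b0 = C" "b2 \<bullet> b1 = C" "b3 \<bullet> b2 = C" "b4 \<bullet> b3 = C" "b4 \<bullet> b0 = C"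
    "b2 \<bullet> b0 = D" "b3 \<bullet> b1 = D" "b4 \<bullet> b2 = D" "b3 \<bullet> b0 = D" "b4 \<bullet> b1 = D"
    using tab by (simp_all only: inner_commute)
  note tb = tab tab' 
  have r2: "r\<^sup>2 > 0" using r by simp
  have CD: "D < C" "C < r\<^sup>2" "D < 0"
    using mult_strict_left_mono[OF _ r2, of "- \<phi> / 2" "(\<phi> - 1) / 2"]
      mult_strict_left_mono[OF _ r2, of "(\<phi> - 1) / 2" 1] mult_strict_left_mono[OF _ r2, of "- \<phi> / 2" 0]
      phi1 unfolding C_def D_def by auto
  have ne: "b1 \<noteq> b4" using tb CD by auto
  have ext: "x extreme_point_of F \<longleftrightarrow> x \<in> {a + b0, a + b1, a + b2, a + b3, a + b4}" for x
    unfolding F by (rule extreme_point_of_cospherical_hull[of _ a r])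
      (use r tab in \<open>auto simp: norm_eq_sqrt_inner\<close>)
  have v: "v = a + b0" by (simp add: uw b)
  have L: "r\<^sup>2 * (3 - \<phi>) = r\<^sup>2 + r\<^sup>2 - 2 * C" and D: "r\<^sup>2 * (2 + \<phi>) = r\<^sup>2 + r\<^sup>2 - 2 * D"
    by (simp_all add: C_def D_def field_simps)
  have n2: "(norm (x - y))\<^sup>2 = x \<bullet> x + y \<bullet> y - 2 * (x \<bullet> y)" for x y :: 'a
    by (simp add: power2_norm_eq_inner inner_diff_left inner_diff_right inner_commute[of y x])
  have opp: "a + b1 + \<phi> *\<^sub>R (a + b4 - v) = a + b3" "a + b4 + \<phi> *\<^sub>R (a + b1 - v) = a + b2"
    unfolding v b by (simp_all add: algebra_simps phi phi' add_divide_distrib diff_divide_distrib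
        flip: scaleR_add_left)
  have "figure_at F (r\<^sup>2 * (3 - \<phi>)) (r\<^sup>2 * (2 + \<phi>)) v (a + b1) (a + b4)"
    unfolding figure_at_def
  proof (intro conjI)
    show "{x. x extreme_point_of F \<and> (norm (x - v))\<^sup>2 = r\<^sup>2 * (3 - \<phi>)} = {a + b1, a + b4}"
      using CD unfolding ext v L by (auto simp: n2[of _ b0] tb)
    show "(convex hull {v, a + b1}) face_of F" "(convex hull {v, a + b4}) face_of F"
      unfolding v F using CD by (auto intro!: side_face_of_cospherical_hull simp: tb)
  qed (use ne in \<open>auto simp: n2 tb D\<close>)
  moreover have "(norm (a + b3 - (a + b4)))\<^sup>2 = r\<^sup>2 * (3 - \<phi>)" "(norm (a + b2 - (a + b1)))\<^sup>2 = r\<^sup>2 * (3 - \<phi>)"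
    unfolding L by (simp_all add: n2 tb)
  ultimately show thesis
    using that[of "a + b1" "a + b4"] unfolding opp by (auto simp: ext)
qed

subsection \<open>Spherical designs and centroids\<close>

lemma odd_moment_of_symmetric:
  fixes V :: "'a::real_inner set"
  assumes "uminus ` V = V" "odd k"
  shows "(\<Sum>p\<in>V. (x \<bullet> p) ^ k) = 0"
proof -
  have "(\<Sum>p\<in>V. (x \<bullet> p) ^ k) = (\<Sum>p\<in>uminus ` V. (x \<bullet> p) ^ k)"
    by (simp add: assms(1))
  also have "\<dots> = - (\<Sum>p\<in>V. (x \<bullet> p) ^ k)"
    using assms(2) by (subst sum.reindex) (auto simp: sum_negf)
  finally show ?thesis by simp
qed

text \<open>
  The factors \<open>1 / 3\<close> and \<open>1 / 5\<close> are the second and fourth moments of a coordinate on the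
  unit sphere in dimension 3.
\<close>

definition design_profile :: "nat \<Rightarrow> real \<Rightarrow> real" where
  "design_profile m s = (s + 1) ^ m + real (m choose 2) * (s + 1) ^ (m - 2) * (4 * s / 3)
     + real (m choose 4) * (s + 1) ^ (m - 4) * (16 * s\<^sup>2 / 5)"

lemma sum_power_dist_design:
  fixes V :: "'a::real_inner set"
  assumes V: "\<And>p. p \<in> V \<Longrightarrow> p \<bullet> p = 1" "uminus ` V = V"
    and M2: "(\<Sum>p\<in>V. (x \<bullet> p) ^ 2) = real (card V) / 3 * (x \<bullet> x)"
    and M4: "(\<Sum>p\<in>V. (x \<bullet> p) ^ 4) = real (card V) / 5 * (x \<bullet> x)\<^sup>2"
    and m: "m \<in> {1, 2, 3, 4, 5}"
  shows "(\<Sum>p\<in>V. norm (x - p) ^ (2 * m)) = real (card V) * design_profile m (x \<bullet> x)"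
proof -
  define t where "t = x \<bullet> x + 1"
  define M where "M k = (\<Sum>p\<in>V. (x \<bullet> p) ^ k)" for k
  have M: "M 0 = card V" "M 1 = 0" "M (Suc 0) = 0" "M 2 = real (card V) / 3 * (x \<bullet> x)" "M 3 = 0"
    "M 4 = real (card V) / 5 * (x \<bullet> x)\<^sup>2" "M 5 = 0"
    using odd_moment_of_symmetric[OF V(2), of 1 x] odd_moment_of_symmetric[OF V(2), of 3 x]
      odd_moment_of_symmetric[OF V(2), of 5 x] M2 M4 by (simp_all add: M_def)
  have M': "M (Suc (Suc 0)) = real (card V) / 3 * (x \<bullet> x)" "M (Suc (Suc (Suc 0))) = 0"
    "M (Suc (Suc (Suc (Suc 0)))) = real (card V) / 5 * (x \<bullet> x)\<^sup>2"
    "M (Suc (Suc (Suc (Suc (Suc 0))))) = 0"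
    using M(4-7) by (simp_all add: eval_nat_numeral)
  have "norm (x - p) ^ (2 * m) = (t + (- 2) * (x \<bullet> p)) ^ m" if "p \<in> V" for p
  proof -
    have "(norm (x - p))\<^sup>2 = t - 2 * (x \<bullet> p)"
      using V(1)[OF that]
      by (simp add: t_def power2_norm_eq_inner inner_diff_left inner_diff_right inner_commute[of p x])
    then show ?thesis by (simp add: power_mult)
  qed
  then have "(\<Sum>p\<in>V. norm (x - p) ^ (2 * m)) = (\<Sum>p\<in>V. (t + (- 2) * (x \<bullet> p)) ^ m)"
    by simp
  also have "\<dots> = (\<Sum>p\<in>V. \<Sum>k\<le>m. of_nat (m choose k) * ((- 2) * (x \<bullet> p)) ^ k * t ^ (m - k))"
    by (subst add.commute) (simp only: binomial_ring)
  also have "\<dots> = (\<Sum>k\<le>m. of_nat (m choose k) * (- 2) ^ k * t ^ (m - k) * M k)"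
    by (subst sum.swap) (simp only: M_def sum_distrib_left power_mult_distrib mult_ac)
  \<comment> \<open>For \<open>m \<le> 5\<close> only the moments of order 0, 2 and 4 survive; with
    \<open>(- 2)^2\<close> and \<open>(- 2)^4\<close> they give the factors 4 / 3 and 16 / 5. For
    small \<open>m\<close> a truncated exponent in \<open>design_profile\<close> comes with a zero
    binomial coefficient.\<close>
  also have "\<dots> = real (card V) * design_profile m (x \<bullet> x)"
    using m by (auto simp: eval_nat_numeral atMost_Suc M(1-3) M' design_profile_def t_def field_simps)
  finally show ?thesis .
qed

lemma design_profile_strict_mono:
  assumes "m \<ge> 1" "0 \<le> s" "s < t"
  shows "design_profile m s < design_profile m t"
proof -
  have "(s + 1) ^ m < (t + 1) ^ m"
    using assms by (intro power_strict_mono) auto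
  moreover have "real (m choose 2) * (s + 1) ^ (m - 2) * (4 * s / 3)
      \<le> real (m choose 2) * (t + 1) ^ (m - 2) * (4 * t / 3)"
    using assms by (intro mult_mono power_mono) auto
  moreover have "real (m choose 4) * (s + 1) ^ (m - 4) * (16 * s\<^sup>2 / 5)
      \<le> real (m choose 4) * (t + 1) ^ (m - 4) * (16 * t\<^sup>2 / 5)"
    using assms by (intro mult_mono power_mono divide_right_mono) auto
  ultimately show ?thesis unfolding design_profile_def by linarith
qed

text \<open>Intermediate values on the interval from 0 to \<open>c\<close>: the profile is 1 at 0,
  and at \<open>c\<close> its first term alone is at least \<open>c\<close>.\<close>

lemma design_profile_attains:
  assumes "m \<ge> 1" "c > 1"
  obtains s where "s > 0" "design_profile m s = c"
proof -
  have "design_profile m 0 = 1" by (simp add: design_profile_def)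
  moreover have "c \<le> design_profile m c"
  proof -
    have "c \<le> (c + 1) ^ 1" by simp
    also have "\<dots> \<le> (c + 1) ^ m" using assms by (intro power_increasing) auto
    also have "\<dots> \<le> design_profile m c" using assms by (simp add: design_profile_def)
    finally show ?thesis .
  qed
  moreover have "continuous_on {0..c} (design_profile m)"
    unfolding design_profile_def by (intro continuous_intros) auto
  ultimately obtain s where "0 \<le> s" "s \<le> c" "design_profile m s = c"
    using IVT'[of "design_profile m" 0 c c] assms by auto
  moreover have "s \<noteq> 0" using \<open>design_profile m s = c\<close> \<open>design_profile m 0 = 1\<close> assms by auto
  ultimately show thesis using that[of s] by simp
qed

lemma locus_of_design:
  fixes V :: "'a::real_inner set"
  assumes "\<And>p. p \<in> V \<Longrightarrow> p \<bullet> p = 1" "uminus ` V = V"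
    and "\<And>x. (\<Sum>p\<in>V. (x \<bullet> p) ^ 2) = real (card V) / 3 * (x \<bullet> x)"
    and "\<And>x. (\<Sum>p\<in>V. (x \<bullet> p) ^ 4) = real (card V) / 5 * (x \<bullet> x)\<^sup>2"
    and m: "m \<in> {1, 2, 3, 4, 5}" and c: "c > real (card V)" and "card V > 0"
  obtains r where "r > 0" "{x. (\<Sum>p\<in>V. norm (x - p) ^ (2 * m)) = c} = {x. norm x = r}"
proof -
  have m1: "m \<ge> 1" using m by auto
  obtain s where s: "s > 0" "design_profile m s = c / real (card V)"
    using design_profile_attains[OF m1, of "c / real (card V)"] assms(6,7) by auto
  have "(\<Sum>p\<in>V. norm (x - p) ^ (2 * m)) = c \<longleftrightarrow> norm x = sqrt s" for x
  proof -
    have sum: "(\<Sum>p\<in>V. norm (x - p) ^ (2 * m)) = real (card V) * design_profile m (x \<bullet> x)"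
      by (rule sum_power_dist_design) (use assms in auto)
    have "(\<Sum>p\<in>V. norm (x - p) ^ (2 * m)) = c \<longleftrightarrow> design_profile m (x \<bullet> x) = design_profile m s"
      using assms(7) unfolding sum s(2) by (simp add: field_simps)
    also have "\<dots> \<longleftrightarrow> x \<bullet> x = s"
      using design_profile_strict_mono[OF m1, of "x \<bullet> x" s] design_profile_strict_mono[OF m1, of s "x \<bullet> x"] s(1)
      by (metis inner_ge_zero less_irrefl linorder_neqE order_less_imp_le)
    also have "\<dots> \<longleftrightarrow> norm x = sqrt s"
      by (simp add: norm_eq_sqrt_inner)
    finally show ?thesis .
  qed
  then show thesis using that[of "sqrt s"] s(1) by auto
qed

section \<open>Centroids of centrally symmetric bodies\<close>

lemma lborel_distr_reflect:
  fixes t :: "'a::euclidean_space"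
  shows "distr lborel borel (\<lambda>x. t - x) = (lborel :: 'a measure)"
  using lborel_affine[of "-1" t] by (simp add: density_1)

text \<open>The function \<open>x - z\<close> is odd under the reflection in \<open>z\<close>, which
  preserves both \<open>P\<close> and Lebesgue measure, so its integral over \<open>P\<close> is
  zero.\<close>

lemma integral_id_of_symmetric:
  fixes P :: "'a::euclidean_space set"
  assumes "compact P" and sym: "(\<lambda>x. 2 *\<^sub>R z - x) ` P = P"
  shows "integral P (\<lambda>x. x) = measure lebesgue P *\<^sub>R z"
proof -
  have mem: "2 *\<^sub>R z - x \<in> P \<longleftrightarrow> x \<in> P" for x
  proof
    show "x \<in> P" if "2 *\<^sub>R z - x \<in> P"
      using imageI[OF that, of "\<lambda>x. 2 *\<^sub>R z - x"] sym by simp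
    show "2 *\<^sub>R z - x \<in> P" if "x \<in> P" using that sym by blast
  qed
  have sets: "P \<in> sets borel" using assms(1) by (simp add: borel_compact)
  have int: "set_integrable lborel P (\<lambda>x. x - z)"
    unfolding set_integrable_def
    by (rule borel_integrable_compact[OF assms(1)]) (intro continuous_intros)
  define g where "g x = indicat_real P x *\<^sub>R (x - z)" for x
  have g: "g \<in> borel_measurable borel"
    unfolding g_def using sets by measurable
  have "integral\<^sup>L lborel g = integral\<^sup>L (distr lborel borel (\<lambda>x. 2 *\<^sub>R z - x)) g"
    by (simp add: lborel_distr_reflect)
  also have "\<dots> = (LINT x|lborel. g (2 *\<^sub>R z - x))"
    using g by (intro integral_distr) auto
  also have "(\<lambda>x. g (2 *\<^sub>R z - x)) = (\<lambda>x. - g x)"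
    unfolding g_def indicator_def mem by (auto simp: scaleR_2)
  finally have "integral\<^sup>L lborel g = - integral\<^sup>L lborel g" by simp
  then have "2 *\<^sub>R integral\<^sup>L lborel g = 0" by (simp only: eq_neg_iff_add_eq_0 scaleR_2)
  then have "(LINT x:P|lborel. x - z) = 0"
    by (simp add: g_def[abs_def] set_lebesgue_integral_def)
  then have 0: "((\<lambda>x. x - z) has_integral 0) P"
    using set_borel_integral_eq_integral[OF int] by (metis integrable_integral)
  have "P \<in> lmeasurable" using assms(1) by (rule lmeasurable_compact)
  then have "((\<lambda>x. z) has_integral measure lebesgue P *\<^sub>R z) P"
    using has_integral_scaleR_left[of "\<lambda>x. 1" "measure lebesgue P" P z]
    by (simp add: lmeasure_integral lmeasurable_iff_integrable_on has_integral_integral[symmetric])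
  from has_integral_add[OF 0 this] show ?thesis by (simp add: integral_unique)
qed

text \<open>Full dimension makes the volume nonzero, so that the division in \<open>centroid\<close>
  is a genuine one.\<close>

lemma centroid_of_symmetric:
  fixes P :: "'a::euclidean_space set"
  assumes "compact P" "convex P" "aff_dim P = DIM('a)" "(\<lambda>x. 2 *\<^sub>R z - x) ` P = P"
  shows "centroid P = z"
proof -
  have "interior P \<noteq> {}"
    using assms(2,3) by (metis aff_dim_eq_full aff_dim_empty rel_interior_eq_empty rel_interior_interior
        of_nat_0_le_iff le_minus_one_simps(3))
  then have "\<not> negligible P"
    using negligible_convex_interior[OF assms(2)] by simp
  then have "measure lebesgue P \<noteq> 0"
    using negligible_iff_measure0[of P] lmeasurable_compact[OF assms(1)] by simp
  then show ?thesis
    by (simp add: centroid_def integral_id_of_symmetric[OF assms(1,4)])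
qed

subsection \<open>Inscribed Platonic solids\<close>

text \<open>The bound on \<open>D\<close> says that a facet is not straight at a vertex:
  \<open>D = 4 * L\<close> would put \<open>v\<close> midway between its two neighbours.\<close>

locale inscribed_platonic =
  fixes P :: "(real^3) set" and z :: "real^3" and R L D :: real and q :: nat
  assumes polytope: "polytope P" and solid: "aff_dim P = 3"
    and R: "R > 0" and on_sphere: "vertices P \<subseteq> sphere z R"
    and LD: "0 < L" "D < 4 * L"
    and figure: "F facet_of P \<Longrightarrow> v extreme_point_of F \<Longrightarrow> \<exists>w w'. figure_at F L D v w w'"
    and vertex_degree: "v \<in> vertices P \<Longrightarrow> card {F. F facet_of P \<and> v \<in> F} = q"
begin

definition T :: "real^3 \<Rightarrow> real^3" where "T x = (1 / R) *\<^sub>R (x - z)"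

definition facet_vertices :: "(real^3) set set" where
  "facet_vertices = {T ` (vertices P \<inter> F) |F. F facet_of P}"

lemma T_inj: "T x = T y \<longleftrightarrow> x = y"
  using R by (simp add: T_def)

lemma mem_T_image: "T x \<in> T ` A \<longleftrightarrow> x \<in> A"
  using T_inj by auto

lemma extreme_point_of_facet:
  "F facet_of P \<Longrightarrow> x extreme_point_of F \<longleftrightarrow> x \<in> vertices P \<and> x \<in> F"
  by (simp add: extreme_point_of_face[OF facet_of_imp_face_of] vertices_def)

lemma facet_hull: "F facet_of P \<Longrightarrow> F = convex hull (vertices P \<inter> F)"
proof -
  assume F: "F facet_of P"
  then have "polytope F"
    using face_of_polytope_polytope facet_of_imp_face_of polytope by blast
  then have "F = convex hull {x. x extreme_point_of F}"
    by (intro Krein_Milman_Minkowski) (auto simp: polytope_imp_compact polytope_imp_convex)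
  then show ?thesis
    using extreme_point_of_facet[OF F] by (simp add: Int_def)
qed

lemma inner_T:
  assumes "x \<in> vertices P" "y \<in> vertices P"
  shows "T x \<bullet> T y = 1 - (norm (x - y))\<^sup>2 / (2 * R\<^sup>2)"
proof -
  define X Y where "X = x - z" and "Y = y - z"
  have "norm X = R" "norm Y = R"
    using assms on_sphere by (auto simp: X_def Y_def dist_norm norm_minus_commute)
  then have n: "X \<bullet> X = R\<^sup>2" "Y \<bullet> Y = R\<^sup>2" by (simp_all add: power2_norm_eq_inner[symmetric])
  have "(norm (x - y))\<^sup>2 = (X - Y) \<bullet> (X - Y)"
    by (simp add: X_def Y_def power2_norm_eq_inner)
  also have "\<dots> = 2 * R\<^sup>2 - 2 * (X \<bullet> Y)"
    using n by (simp add: inner_diff_left inner_diff_right inner_commute[of Y X])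
  finally show ?thesis
    using R by (simp add: T_def X_def[symmetric] Y_def[symmetric] field_simps power2_eq_square)
qed

lemma inner_T_eq:
  assumes "x \<in> vertices P" "y \<in> vertices P"
  shows "T x \<bullet> T y = 1 - d / (2 * R\<^sup>2) \<longleftrightarrow> (norm (x - y))\<^sup>2 = d"
  using R by (simp add: inner_T[OF assms])

lemma facet_figure:
  assumes "F facet_of P" "v \<in> vertices P \<inter> F"
  shows "\<exists>w w'. figure_at F L D v w w'"
  by (rule figure[OF assms(1)]) (use assms extreme_point_of_facet in blast)

lemma figure_vertices:
  assumes "F facet_of P" "figure_at F L D v w w'"
  shows "{x \<in> vertices P \<inter> F. (norm (x - v))\<^sup>2 = L} = {w, w'}" "w \<in> vertices P" "w' \<in> vertices P"
    "w \<in> F" "w' \<in> F" "(norm (w - v))\<^sup>2 = L" "(norm (w' - v))\<^sup>2 = L"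
  using assms unfolding figure_at_def extreme_point_of_facet[OF assms(1)] by auto

text \<open>Distinct facets meet in dimension at most one, so the three common vertices would be
  collinear; then \<open>v\<close>, equidistant from \<open>w\<close> and \<open>w'\<close>, would
  be their midpoint, against \<open>D < 4 * L\<close>.\<close>

lemma facet_eqI_corner:
  assumes "F facet_of P" "G facet_of P" "{v, w, w'} \<subseteq> vertices P \<inter> F \<inter> G" "w \<noteq> w'"
    "(norm (w - v))\<^sup>2 = L" "(norm (w' - v))\<^sup>2 = L"
  shows "F = G"
proof (rule ccontr)
  assume "F \<noteq> G"
  have face: "F face_of P" "G face_of P" and dim: "aff_dim F = 2" "aff_dim G = 2"
    using assms(1,2) solid by (auto simp: facet_of_def)
  have "F \<inter> G face_of F"
    using face face_of_Int face_of_subset face_of_imp_subset by (metis inf_le1)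
  moreover have "F \<inter> G \<noteq> F"
  proof
    assume "F \<inter> G = F"
    then have "F face_of G"
      using face face_of_subset face_of_imp_subset by (metis inf_le2)
    then show False
      using face_of_aff_dim_lt[of G F] face_of_imp_convex[OF face(2)] dim \<open>F \<noteq> G\<close> by auto
  qed
  ultimately have "aff_dim (F \<inter> G) < 2"
    using face_of_aff_dim_lt[of F "F \<inter> G"] face_of_imp_convex[OF face(1)] dim by auto
  then have "aff_dim {v, w, w'} \<le> 1"
    using aff_dim_subset[of "{v, w, w'}" "F \<inter> G"] assms(3) by auto
  then have "collinear {v, w, w'}" by (simp add: collinear_aff_dim)
  then obtain u where u: "\<And>x y. x \<in> {v, w, w'} \<Longrightarrow> y \<in> {v, w, w'} \<Longrightarrow> \<exists>c. x - y = c *\<^sub>R u"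
    unfolding collinear_def by blast
  obtain s t where st: "w - v = s *\<^sub>R u" "w' - v = t *\<^sub>R u"
    using u[of w v] u[of w' v] by auto
  have "s\<^sup>2 * (norm u)\<^sup>2 = t\<^sup>2 * (norm u)\<^sup>2" "u \<noteq> 0"
    using assms(5,6) LD unfolding st by (auto simp: power_mult_distrib)
  then have "s = t \<or> s = - t" by (auto simp: power2_eq_iff)
  moreover have "s \<noteq> t" using st assms(4) by (metis diff_add_cancel)
  ultimately have t: "t = - s" by auto
  have "w - w' = (w - v) - (w' - v)" by simp
  also have "\<dots> = 2 *\<^sub>R (w - v)" unfolding st t by (simp only: scaleR_minus_left diff_minus_eq_add scaleR_2)
  finally have "w - w' = 2 *\<^sub>R (w - v)" .
  then have "(norm (w - w'))\<^sup>2 = 4 * L"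
    using assms(5) by (simp add: power_mult_distrib)
  moreover have "(norm (w - w'))\<^sup>2 = D"
  proof -
    obtain x x' where x: "figure_at F L D v x x'"
      using facet_figure[OF assms(1)] assms(3) by blast
    have "{w, w'} \<subseteq> {x, x'}"
      unfolding figure_vertices(1)[OF assms(1) x, symmetric] using assms(3,5,6) by auto
    then have "{w, w'} = {x, x'}" using assms(4) by auto
    then have "norm (w - w') = norm (x - x')"
      by (metis doubleton_eq_iff norm_minus_commute)
    then show ?thesis using x by (simp add: figure_at_def)
  qed
  ultimately show False using LD by simp
qed

lemma facet_across_side:
  assumes F: "F facet_of P" "v \<in> vertices P \<inter> F" "w \<in> vertices P \<inter> F" "(norm (w - v))\<^sup>2 = L"
  obtains G where "G facet_of P" "G \<noteq> F" "v \<in> G" "w \<in> G"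
proof -
  obtain x x' where x: "figure_at F L D v x x'"
    using facet_figure F by blast
  have "w = x \<or> w = x'"
    using figure_vertices(1)[OF F(1) x] F by auto
  then have "(convex hull {v, w}) face_of F"
    using x by (auto simp: figure_at_def)
  then have face: "(convex hull {v, w}) face_of P"
    using F(1) face_of_trans facet_of_imp_face_of by blast
  have dim: "aff_dim (convex hull {v, w}) \<le> 1"
    using aff_dim_2[of v w] by (simp add: aff_dim_convex_hull)
  have "convex hull {v, w} = \<Inter>{G. G facet_of P \<and> convex hull {v, w} \<subseteq> G}"
    by (rule face_of_polyhedron[OF polytope_imp_polyhedron[OF polytope] face])
      (use dim solid in auto)
  moreover have "aff_dim F = 2" using F(1) solid by (simp add: facet_of_def)
  \<comment> \<open>With \<open>F\<close> alone the intersection would be \<open>F\<close>, which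
    has dimension 2, while the side has dimension at most 1.\<close>
  ultimately have "{G. G facet_of P \<and> convex hull {v, w} \<subseteq> G} \<noteq> {F}"
    using dim by auto
  moreover have "F \<in> {G. G facet_of P \<and> convex hull {v, w} \<subseteq> G}"
    using F hull_minimal[of "{v, w}" F convex] face_of_imp_convex[OF facet_of_imp_face_of[OF F(1)]]
    by simp
  ultimately obtain G where "G facet_of P" "convex hull {v, w} \<subseteq> G" "G \<noteq> F" by blast
  then show thesis
    using that hull_subset[of "{v, w}" convex] by auto
qed

lemma vertex_figures:
  "vertex_figures (T ` vertices P) facet_vertices (1 - L / (2 * R\<^sup>2)) (1 - D / (2 * R\<^sup>2)) q"
proof
  fix f assume f: "f \<in> facet_vertices"
  then show "f \<subseteq> T ` vertices P" by (auto simp: facet_vertices_def)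
  obtain F where F: "F facet_of P" "f = T ` (vertices P \<inter> F)"
    using f by (auto simp: facet_vertices_def)
  { fix v assume "v \<in> f"
    then obtain x where x: "x \<in> vertices P \<inter> F" "v = T x" using F by auto
    obtain w w' where w: "figure_at F L D x w w'"
      using facet_figure F x by blast
    note fv = figure_vertices[OF F(1) w]
    have "{y \<in> f. y \<bullet> v = 1 - L / (2 * R\<^sup>2)} = T ` {y \<in> vertices P \<inter> F. (norm (y - x))\<^sup>2 = L}"
      using x(1) inner_T_eq unfolding F(2) x(2) by blast
    then have "{y \<in> f. y \<bullet> v = 1 - L / (2 * R\<^sup>2)} = {T w, T w'}"
      unfolding fv(1) by simp
    moreover have "T w \<noteq> T w'" "T w \<bullet> T w' = 1 - D / (2 * R\<^sup>2)"
      using w fv inner_T_eq by (auto simp: figure_at_def T_inj)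
    ultimately show "\<exists>w w'. w \<noteq> w' \<and> {y \<in> f. y \<bullet> v = 1 - L / (2 * R\<^sup>2)} = {w, w'} \<and>
        w \<bullet> w' = 1 - D / (2 * R\<^sup>2)" by blast }
  { fix v w assume vw: "v \<in> f" "w \<in> f" "w \<bullet> v = 1 - L / (2 * R\<^sup>2)"
    then obtain x y where xy: "x \<in> vertices P \<inter> F" "v = T x" "y \<in> vertices P \<inter> F" "w = T y"
      using F by auto
    then have "(norm (y - x))\<^sup>2 = L" using vw(3) inner_T_eq by auto
    then obtain G where G: "G facet_of P" "G \<noteq> F" "x \<in> G" "y \<in> G"
      using facet_across_side[OF F(1) xy(1,3)] by blast
    have "T ` (vertices P \<inter> G) \<noteq> f"
    proof
      assume "T ` (vertices P \<inter> G) = f"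
      then have "vertices P \<inter> G = vertices P \<inter> F"
        unfolding F(2) using T_inj by (auto simp: inj_image_eq_iff inj_def)
      then show False using facet_hull[OF F(1)] facet_hull[OF G(1)] G(2) by auto
    qed
    then show "\<exists>g\<in>facet_vertices. g \<noteq> f \<and> v \<in> g \<and> w \<in> g"
      using G xy by (intro bexI[of _ "T ` (vertices P \<inter> G)"]) (auto simp: facet_vertices_def) }
  { fix g v w w' assume g: "g \<in> facet_vertices" "{v, w, w'} \<subseteq> f \<inter> g" "w \<noteq> w'"
      "w \<bullet> v = 1 - L / (2 * R\<^sup>2)" "w' \<bullet> v = 1 - L / (2 * R\<^sup>2)"
    obtain G where G: "G facet_of P" "g = T ` (vertices P \<inter> G)"
      using g(1) by (auto simp: facet_vertices_def)
    obtain x y y' where xy: "v = T x" "w = T y" "w' = T y'" "{x, y, y'} \<subseteq> vertices P \<inter> F"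
      using g(2) F(2) by auto
    moreover have "{x, y, y'} \<subseteq> G"
      using g(2) xy(1-3) by (simp add: G(2) mem_T_image)
    ultimately have "F = G"
      using g(3-5) by (intro facet_eqI_corner[OF F(1) G(1), of x y y']) (auto simp: inner_T_eq)
    then show "f = g" by (simp add: F G) }
next
  fix v assume "v \<in> T ` vertices P"
  then obtain x where x: "x \<in> vertices P" "v = T x" by auto
  show "v \<bullet> v = 1" using x inner_T[of x x] by simp
  \<comment> \<open>A facet is the hull of its vertices, so counting vertex sets is the same as
    counting facets.\<close>
  have "inj_on (\<lambda>F. T ` (vertices P \<inter> F)) {F. F facet_of P \<and> x \<in> F}"
  proof (rule inj_onI)
    fix F G assume FG: "F \<in> {F. F facet_of P \<and> x \<in> F}" "G \<in> {F. F facet_of P \<and> x \<in> F}"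
      "T ` (vertices P \<inter> F) = T ` (vertices P \<inter> G)"
    then have "vertices P \<inter> F = vertices P \<inter> G"
      using T_inj by (auto simp: inj_image_eq_iff inj_def)
    then show "F = G" using FG facet_hull[of F] facet_hull[of G] by auto
  qed
  moreover have "(\<lambda>F. T ` (vertices P \<inter> F)) ` {F. F facet_of P \<and> x \<in> F} = {f \<in> facet_vertices. v \<in> f}"
    using x(1) unfolding x(2) by (auto simp: facet_vertices_def mem_T_image T_inj)
  ultimately show "card {f \<in> facet_vertices. v \<in> f} = q"
    using vertex_degree[OF x(1)] card_image[of "\<lambda>F. T ` (vertices P \<inter> F)" "{F. F facet_of P \<and> x \<in> F}"]
    by simp
next
  show "1 - L / (2 * R\<^sup>2) < 1" using LD R by simp
qed

lemma T_combination: "T x + t *\<^sub>R (T y - T v) = T (x + t *\<^sub>R (y - v))"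
  by (simp add: T_def algebra_simps)

lemma T_vertices_card: "card (T ` vertices P) = card (vertices P)"
  by (intro card_image inj_onI) (simp add: T_inj)

text \<open>\<open>T\<close> is a similarity, so the locus is carried over from the unit sphere and
  is centred at \<open>z\<close>. Central symmetry of the vertices passes to their hull
  \<open>P\<close>, which puts the centroid at \<open>z\<close> too.\<close>

lemma locus_and_centroid:
  assumes sym: "uminus ` T ` vertices P = T ` vertices P"
    and M2: "\<And>x. (\<Sum>p\<in>T ` vertices P. (x \<bullet> p) ^ 2) = real n / 3 * (x \<bullet> x)"
    and M4: "\<And>x. (\<Sum>p\<in>T ` vertices P. (x \<bullet> p) ^ 4) = real n / 5 * (x \<bullet> x)\<^sup>2"
    and n: "card (vertices P) = n" "n > 0" and m: "m \<in> {1, 2, 3, 4, 5}"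
    and c: "c > real n * R ^ (2 * m)"
  shows "\<exists>r>0. {M. (\<Sum>v\<in>vertices P. dist M v ^ (2 * m)) = c} = sphere (centroid P) r"
proof -
  have Rm: "R ^ (2 * m) > 0" using R by simp
  have cT: "card (T ` vertices P) = n" using T_vertices_card n by simp
  have unit: "p \<bullet> p = 1" if "p \<in> T ` vertices P" for p
    using that inner_T by auto
  obtain \<rho> where \<rho>: "\<rho> > 0" "{x. (\<Sum>p\<in>T ` vertices P. norm (x - p) ^ (2 * m)) = c / R ^ (2 * m)} = {x. norm x = \<rho>}"
    using locus_of_design[OF unit sym _ _ m, of "c / R ^ (2 * m)"] M2 M4 n(2) c Rm
    unfolding cT by (auto simp: pos_less_divide_eq)
  have "(\<Sum>v\<in>vertices P. dist M v ^ (2 * m)) = c \<longleftrightarrow> dist z M = R * \<rho>" for M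
  proof -
    have "dist M v = R * norm (T M - T v)" for v
    proof -
      have "T M - T v = (1 / R) *\<^sub>R (M - v)" by (simp add: T_def algebra_simps)
      then show ?thesis using R by (simp add: dist_norm)
    qed
    then have "(\<Sum>v\<in>vertices P. dist M v ^ (2 * m)) = R ^ (2 * m) * (\<Sum>p\<in>T ` vertices P. norm (T M - p) ^ (2 * m))"
      by (subst sum.reindex) (auto simp: inj_on_def T_inj sum_distrib_left power_mult_distrib)
    then have "(\<Sum>v\<in>vertices P. dist M v ^ (2 * m)) = c \<longleftrightarrow>
        T M \<in> {x. (\<Sum>p\<in>T ` vertices P. norm (x - p) ^ (2 * m)) = c / R ^ (2 * m)}"
      using R by (simp add: field_simps)
    also have "\<dots> \<longleftrightarrow> dist z M = R * \<rho>"
    proof -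
      have "dist z M = R * norm (T M)"
        using R by (simp add: T_def dist_norm norm_minus_commute)
      then show ?thesis unfolding \<rho>(2) using R by simp
    qed
    finally show ?thesis .
  qed
  then have locus: "{M. (\<Sum>v\<in>vertices P. dist M v ^ (2 * m)) = c} = sphere z (R * \<rho>)"
    by (auto simp: sphere_def)
  have refl: "T (2 *\<^sub>R z - x) = - T x" for x
  proof -
    have "2 *\<^sub>R z - x - z = - (x - z)" by (simp add: scaleR_2)
    then show ?thesis unfolding T_def by (simp only: scaleR_minus_right)
  qed
  have "2 *\<^sub>R z - x \<in> vertices P" if "x \<in> vertices P" for x
    using sym that refl mem_T_image by (metis image_eqI)
  then have "(\<lambda>x. 2 *\<^sub>R z - x) ` vertices P \<subseteq> vertices P" by auto
  moreover have "x \<in> (\<lambda>x. 2 *\<^sub>R z - x) ` vertices P" if "x \<in> vertices P" for x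
    using \<open>\<And>x. x \<in> vertices P \<Longrightarrow> 2 *\<^sub>R z - x \<in> vertices P\<close>[OF that]
    by (intro image_eqI[of _ _ "2 *\<^sub>R z - x"]) auto
  ultimately have V: "(\<lambda>x. 2 *\<^sub>R z + (- 1) *\<^sub>R x) ` vertices P = vertices P" by auto
  have comp: "compact P" "convex P"
    using polytope polytope_imp_compact polytope_imp_convex by auto
  have "P = convex hull vertices P"
    unfolding vertices_def using comp by (rule Krein_Milman_Minkowski)
  then have "(\<lambda>x. 2 *\<^sub>R z + (- 1) *\<^sub>R x) ` P = P"
    using convex_hull_affinity[of "2 *\<^sub>R z" "- 1" "vertices P"] V by metis
  then have "centroid P = z"
    using comp solid by (intro centroid_of_symmetric) auto
  then show ?thesis using locus \<rho>(1) R by (intro exI[of _ "R * \<rho>"]) auto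
qed

end

section \<open>The two solids as inscribed Platonic solids\<close>

theorem theorem6p4:
  fixes P :: "(real^3) set" and A :: "nat \<Rightarrow> real^3" and n m :: nat and R c :: real
  assumes "(regular_icosahedron P \<and> n = 12) \<or> (regular_dodecahedron P \<and> n = 20)"
    and "bij_betw A {1..n} (vertices P)"
    and "R > 0" and "has_circumradius P R"
    and "m \<in> {1, 2, 3, 4, 5}"
    and "c > real n * R ^ (2 * m)"
  shows "\<exists>r>0. {M. (\<Sum>i=1..n. dist M (A i) ^ (2 * m)) = c} = sphere (centroid P) r"
proof -
  have sum: "(\<Sum>i=1..n. dist M (A i) ^ (2 * m)) = (\<Sum>v\<in>vertices P. dist M v ^ (2 * m))" for M
    using sum.reindex_bij_betw[OF assms(2)] .
  have card: "card (vertices P) = n"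
    using bij_betw_same_card[OF assms(2)] by simp
  have n0: "n > 0" using assms(1) by auto
  obtain v0 where v0: "v0 \<in> vertices P" using card n0 by fastforce
  obtain z where z: "vertices P \<subseteq> sphere z R" using assms(4) by (auto simp: has_circumradius_def)
  \<comment> \<open>The circumradius of the faces is known to be positive only through an actual
    facet; one exists because \<open>q\<close> facets pass through \<open>v0\<close>.\<close>
  have pos: "r > 0" if "platonic_solid p q P" "q > 0" "\<forall>F. F facet_of P \<longrightarrow> regular_polygon p r F" for p q r
  proof -
    have "card {F. F facet_of P \<and> v0 \<in> F} = q"
      using that(1) v0 by (auto simp: platonic_solid_def)
    then have "{F. F facet_of P \<and> v0 \<in> F} \<noteq> {}" using that(2) by (metis card.empty less_irrefl)
    then show ?thesis using that(3) by (auto simp: regular_polygon_def)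
  qed
  from assms(1) show ?thesis
  proof (elim disjE conjE)
    assume P: "regular_icosahedron P" and n: "n = 12"
    then have P': "platonic_solid 3 5 P" by (simp add: regular_icosahedron_def)
    then obtain r where r: "\<forall>F. F facet_of P \<longrightarrow> regular_polygon 3 r F"
      by (auto simp: platonic_solid_def)
    have "r > 0" using pos[OF P' _ r] by simp
    \<comment> \<open>The two neighbours of a vertex in a triangle are joined by a side, so both
      squared lengths are \<open>3 * r^2\<close>.\<close>
    interpret inscribed_platonic P z R "3 * r\<^sup>2" "3 * r\<^sup>2" 5
    proof
      show "\<exists>w w'. figure_at F (3 * r\<^sup>2) (3 * r\<^sup>2) v w w'" if "F facet_of P" "v extreme_point_of F" for F v
        using triangle_figure r that by metis
    qed (use P' assms(3) z \<open>r > 0\<close> in \<open>auto simp: platonic_solid_def\<close>)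
    interpret icosahedral_figures "T ` vertices P" facet_vertices "1 - 3 * r\<^sup>2 / (2 * R\<^sup>2)"
      by (intro icosahedral_figures.intro vertex_figures)
    have cT: "card (T ` vertices P) = 12" using T_vertices_card card n by simp
    show ?thesis
      unfolding sum using vertices_icosahedral[OF cT] card n0 assms(5,6)
      by (intro locus_and_centroid[of n]) (simp_all add: n)
  next
    assume P: "regular_dodecahedron P" and n: "n = 20"
    then have P': "platonic_solid 5 3 P" by (simp add: regular_dodecahedron_def)
    then obtain r where r: "\<forall>F. F facet_of P \<longrightarrow> regular_polygon 5 r F"
      by (auto simp: platonic_solid_def)
    have r0: "r > 0" using pos[OF P' _ r] by simp
    define \<phi> :: real where "\<phi> = (1 + sqrt 5) / 2"
    have "2 < sqrt 5" "sqrt 5 < 3" by (auto intro: real_less_rsqrt real_less_lsqrt)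
    then have phi: "1 < \<phi>" "\<phi> < 2" "\<phi>\<^sup>2 = \<phi> + 1" by (simp_all add: \<phi>_def power2_eq_square field_simps)
    define L D where "L = r\<^sup>2 * (3 - \<phi>)" and "D = r\<^sup>2 * (2 + \<phi>)"
    \<comment> \<open>A diagonal is \<open>\<phi>\<close> times as long as a side; this becomes the
      assumption \<open>diagonal\<close>.\<close>
    have D: "D = \<phi>\<^sup>2 * L" unfolding L_def D_def using phi(3) by algebra
    have L0: "L > 0" unfolding L_def using r0 phi by simp
    note fig = pentagon_figure[of r _ _, folded \<phi>_def L_def D_def]
    interpret inscribed_platonic P z R L D 3
    proof
      show "\<exists>w w'. figure_at F L D v w w'" if "F facet_of P" "v extreme_point_of F" for F v
        using fig r that by metis
      show "D < 4 * L" unfolding D phi(3) using L0 phi(2) by simp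
    qed (use P' assms(3) z L0 in \<open>auto simp: platonic_solid_def\<close>)
    interpret dodecahedral_figures "T ` vertices P" facet_vertices "1 - L / (2 * R\<^sup>2)" "1 - D / (2 * R\<^sup>2)" \<phi>
    proof (intro dodecahedral_figures.intro vertex_figures dodecahedral_figures_axioms.intro)
      fix f v w w' assume f: "f \<in> facet_vertices" "{v, w, w'} \<subseteq> f" "w \<noteq> w'"
        "w \<bullet> v = 1 - L / (2 * R\<^sup>2)" "w' \<bullet> v = 1 - L / (2 * R\<^sup>2)"
      obtain F where F: "F facet_of P" "f = T ` (vertices P \<inter> F)"
        using f(1) by (auto simp: facet_vertices_def)
      obtain x y y' where xy: "v = T x" "w = T y" "w' = T y'" "{x, y, y'} \<subseteq> vertices P \<inter> F"
        using f(2) F(2) by auto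
      have "x extreme_point_of F" using extreme_point_of_facet[OF F(1)] xy(4) by simp
      then obtain u u' where u: "figure_at F L D x u u'"
        "u + \<phi> *\<^sub>R (u' - x) extreme_point_of F" "(norm (u + \<phi> *\<^sub>R (u' - x) - u'))\<^sup>2 = L"
        "u' + \<phi> *\<^sub>R (u - x) extreme_point_of F" "(norm (u' + \<phi> *\<^sub>R (u - x) - u))\<^sup>2 = L"
        using fig[of F x] r F(1) by metis
      \<comment> \<open>The neighbours \<open>y\<close>, \<open>y'\<close> may occur in either
        order, which the two mirror versions of the diagonal rule cover.\<close>
      have "{y, y'} \<subseteq> {u, u'}" "y \<noteq> y'"
        using f(3-5) xy figure_vertices(1)[OF F(1) u(1)] by (auto simp: inner_T_eq)
      then have "(y = u \<and> y' = u') \<or> (y = u' \<and> y' = u)" by auto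
      then have "y + \<phi> *\<^sub>R (y' - x) extreme_point_of F" "(norm (y + \<phi> *\<^sub>R (y' - x) - y'))\<^sup>2 = L"
        using u by auto
      then have "y + \<phi> *\<^sub>R (y' - x) \<in> vertices P \<inter> F" "T (y + \<phi> *\<^sub>R (y' - x)) \<bullet> T y' = 1 - L / (2 * R\<^sup>2)"
        using xy(4) extreme_point_of_facet[OF F(1)] by (auto simp: inner_T_eq)
      then show "w + \<phi> *\<^sub>R (w' - v) \<in> f \<and> (w + \<phi> *\<^sub>R (w' - v)) \<bullet> w' = 1 - L / (2 * R\<^sup>2)"
        unfolding xy(1-3) F(2) T_combination by auto
    qed (use phi in \<open>simp_all add: D\<close>)
    have cT: "card (T ` vertices P) = 20" using T_vertices_card card n by simp
    show ?thesis
      unfolding sum using vertices_dodecahedral[OF cT] card n0 assms(5,6)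
      by (intro locus_and_centroid[of n]) (simp_all add: n)
  qed
qed

end
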